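(* Let $n$ be a positive odd integer, and for $k\geqslant 0$ let $$c_q(k)=[3k+1]\frac{(q;q^2)_k^3\, q^{-\binom{k+1}{2}}}{(q;q)_k^2(q^2;q^2)_k}.$$ Then $$\sum_{k=0}^{n-1}\sum_{j=0}^{k}c_q(j)c_q(k-j)\equiv q[n]^2\pmod{[n]\Phi_n(q)^2}.$$
   Context: Here $q$ is an indeterminate. The $q$-shifted factorial is $(x;q)_0=1$ and $(x;q)_m=(1-x)(1-xq)\cdots(1-xq^{m-1})$ for $m\geqslant1$; the $q$-integer is $[m]=1+q+\cdots+q^{m-1}=(1-q^m)/(1-q)$. $\Phi_n(q)$ denotes the $n$-th cyclotomic polynomial. For rational functions $A,B$ in $q$ and a polynomial $P$, $A\equiv B\pmod{P}$ means that $A-B=P\cdot U/V$ for polynomials $U,V$ with $V$ coprime to $P$.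
   Formalization: The case n = 1 is excluded (n is odd and n > 1), because there the congruence would read 1 ≡ q modulo (q−1)², which is false. *)

theory Defs
  imports
    "HOL-Computational_Algebra.Computational_Algebra"
    "HOL-Number_Theory.Totient"
begin

section \<open>Rational functions in an indeterminate\<close>

text \<open>
  Rational functions over the rationals are elements of the fraction field
  \<^typ>\<open>rat poly fract\<close>; a polynomial is regarded as a rational function via \<^const>\<open>to_fract\<close>.
\<close>

definition indet :: "rat poly" where
  "indet = [:0, 1:]"

definition ratfun_cong :: "rat poly fract \<Rightarrow> rat poly fract \<Rightarrow> rat poly \<Rightarrow> bool" where
  "ratfun_cong A B P \<longleftrightarrow>
     (\<exists>U V. V \<noteq> 0 \<and> coprime V P \<and> A - B = to_fract P * (to_fract U / to_fract V))"


section \<open>\<open>q\<close>-analogues\<close>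

definition qpoch :: "'a::comm_ring_1 \<Rightarrow> 'a \<Rightarrow> nat \<Rightarrow> 'a" where
  "qpoch x q m = (\<Prod>i<m. 1 - x * q ^ i)"

definition qint :: "'a::comm_ring_1 \<Rightarrow> nat \<Rightarrow> 'a" where
  "qint q m = (\<Sum>i<m. q ^ i)"

definition cq :: "'a::field \<Rightarrow> nat \<Rightarrow> 'a" where
  "cq q k = qint q (3 * k + 1) *
     ((qpoch q (q\<^sup>2) k) ^ 3 * q powi (- int ((k + 1) choose 2)) /
      ((qpoch q q k)\<^sup>2 * qpoch (q\<^sup>2) (q\<^sup>2) k))"


section \<open>Cyclotomic polynomials\<close>

definition complex_cyclotomic :: "nat \<Rightarrow> complex poly" where
  "complex_cyclotomic n = (\<Prod>k\<in>totatives n. [:- cis (2 * pi * real k / real n), 1:])"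

text \<open>
  The coefficients of \<^const>\<open>complex_cyclotomic\<close> are rational, so the description below
  denotes; see \<open>map_poly_cyclotomic\<close>.
\<close>

definition cyclotomic :: "nat \<Rightarrow> rat poly" where
  "cyclotomic n = (THE p. map_poly of_rat p = complex_cyclotomic n)"

lemma prod_complex_cyclotomic:
  assumes n: "n > 0"
  shows "(\<Prod>d | d dvd n. complex_cyclotomic d) = monom 1 n - 1"
proof -
  let ?f = "\<lambda>k. [:- cis (2 * pi * real k / real n), 1:]"
  have fin: "finite {d. d dvd n}"
    using n by (simp add: finite_divisors_nat)
  have divs: "bij_betw (\<lambda>d. n div d) {d. d dvd n} {d. d dvd n}"
    by (rule bij_betwI[where g = "\<lambda>d. n div d"]) (use n in \<open>auto elim!: dvdE\<close>)
  have cyc: "complex_cyclotomic (n div d) = (\<Prod>k | k \<in> {0<..n} \<and> gcd k n = d. ?f k)"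
    if d: "d dvd n" for d
  proof -
    have "d > 0" using d n by (auto intro: Nat.gr0I)
    have "complex_cyclotomic (n div d) = (\<Prod>k\<in>totatives (n div d). ?f (k * d))"
      unfolding complex_cyclotomic_def
      using d n \<open>d > 0\<close> by (intro prod.cong) (auto elim!: dvdE simp: field_simps)
    also have "\<dots> = (\<Prod>k | k \<in> {0<..n} \<and> gcd k n = d. ?f k)"
      using bij_betw_totatives_gcd_eq[OF d n]
      by (rule prod.reindex_bij_betw)
    finally show ?thesis .
  qed
  have "(\<Prod>d | d dvd n. complex_cyclotomic d) = (\<Prod>d | d dvd n. complex_cyclotomic (n div d))"
    using prod.reindex_bij_betw[OF divs, of complex_cyclotomic] by simp
  also have "\<dots> = (\<Prod>d | d dvd n. \<Prod>k | k \<in> {0<..n} \<and> gcd k n = d. ?f k)"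
    by (intro prod.cong) (simp_all add: cyc)
  also have "\<dots> = (\<Prod>k\<in>{0<..n}. ?f k)"
    by (rule prod.group) (use fin in auto)
  also have "\<dots> = (\<Prod>k<n. ?f k)"
  proof -
    have "{0<..n} = insert n {0<..<n}" "{..<n} = insert 0 {0<..<n}"
      using n by auto
    then show ?thesis using n by simp
  qed
  also have "\<dots> = (\<Prod>z | z ^ n = 1. [:- z, 1:])"
    using prod.reindex_bij_betw[OF bij_betw_roots_unity[OF n], of "\<lambda>z. [:- z, 1:]"] by simp
  also have "\<dots> = monom 1 n - 1"
  proof (rule poly_eqI_degree_lead_coeff[where A = "{z. z ^ n = 1}" and n = n])
    have fin': "finite {z::complex. z ^ n = 1}"
      using n by (simp add: finite_roots_unity)
    have card: "card {z::complex. z ^ n = 1} = n"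
      using n by (simp add: card_roots_unity_eq)
    have deg: "degree (\<Prod>z | z ^ n = 1. [:- z, 1 :: complex:]) = n"
      using card by (subst degree_prod_eq_sum_degree) auto
    then show "degree (\<Prod>z | z ^ n = 1. [:- z, 1 :: complex:]) \<le> n" by simp
    show "degree (monom 1 n - 1 :: complex poly) \<le> n"
      by (rule degree_diff_le) (auto simp: degree_monom_eq)
    have "lead_coeff (\<Prod>z | z ^ n = 1. [:- z, 1 :: complex:]) = 1"
      by (simp add: lead_coeff_prod)
    then show "coeff (\<Prod>z | z ^ n = 1. [:- z, 1 :: complex:]) n =
          coeff (monom 1 n - 1) n"
      using n by (simp add: deg)
    show "n \<le> card {z::complex. z ^ n = 1}"
      by (simp add: card)
    show "poly (\<Prod>z | z ^ n = 1. [:- z, 1:]) z = poly (monom 1 n - 1) z"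
      if "z \<in> {z. z ^ n = 1}" for z :: complex
      using that fin' by (auto simp: poly_prod poly_monom prod_zero_iff)
  qed
  finally show ?thesis .
qed

lemma map_poly_of_rat_inject:
  "map_poly of_rat p = (map_poly of_rat q :: complex poly) \<longleftrightarrow> p = q"
  by (auto simp: poly_eq_iff coeff_map_poly)

lemma map_poly_of_rat_add:
  "map_poly of_rat (p + q) = (map_poly of_rat p + map_poly of_rat q :: complex poly)"
  by (simp add: poly_eq_iff coeff_map_poly of_rat_add)

lemma map_poly_of_rat_mult:
  "map_poly of_rat (p * q) = (map_poly of_rat p * map_poly of_rat q :: complex poly)"
  by (simp add: poly_eq_iff coeff_map_poly coeff_mult of_rat_sum of_rat_mult)

lemma map_poly_of_rat_prod:
  "map_poly of_rat (\<Prod>i\<in>A. f i) = (\<Prod>i\<in>A. map_poly of_rat (f i) :: complex poly)"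
  by (induction A rule: infinite_finite_induct) (simp_all add: map_poly_of_rat_mult)

lemma complex_cyclotomic_nonzero: "complex_cyclotomic n \<noteq> 0"
  by (simp add: complex_cyclotomic_def)

lemma complex_cyclotomic_rational: "\<exists>p. map_poly of_rat p = complex_cyclotomic n"
proof (induction n rule: less_induct)
  case (less n)
  show ?case
  proof (cases "n = 0")
    case True
    then show ?thesis
      by (intro exI[of _ 1]) (simp add: complex_cyclotomic_def)
  next
    case False
    then have n: "n > 0" by simp
    obtain f where f: "map_poly of_rat (f d) = complex_cyclotomic d" if "d < n" for d
      using less.IH by metis
    let ?D = "{d. d dvd n \<and> d < n}"
    let ?h = "map_poly of_rat :: rat poly \<Rightarrow> complex poly"
    define p where "p = (\<Prod>d\<in>?D. f d)"
    define g where "g = (monom 1 n - 1 :: rat poly)"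
    have fin: "finite ?D" by simp
    have hp: "?h p = (\<Prod>d\<in>?D. complex_cyclotomic d)"
      unfolding p_def map_poly_of_rat_prod by (intro prod.cong) (simp_all add: f)
    have "{d. d dvd n} = insert n ?D"
      using n by (auto dest: dvd_imp_le)
    then have "complex_cyclotomic n * ?h p = monom 1 n - 1"
      using prod_complex_cyclotomic[OF n] fin by (simp add: hp)
    also have "\<dots> = ?h g"
      by (simp add: poly_eq_iff coeff_map_poly g_def of_rat_diff coeff_1)
    also have "\<dots> = ?h (g div p) * ?h p + ?h (g mod p)"
      by (simp flip: map_poly_of_rat_mult map_poly_of_rat_add)
    finally have eq: "(complex_cyclotomic n - ?h (g div p)) * ?h p = ?h (g mod p)"
      by (simp add: algebra_simps)
    have hp0: "?h p \<noteq> 0"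
      using fin by (simp add: hp complex_cyclotomic_nonzero)
    have deg: "degree (?h r) = degree r" for r
      by (rule degree_map_poly) simp
    have "complex_cyclotomic n - ?h (g div p) = 0"
    proof (rule ccontr)
      assume nz: "complex_cyclotomic n - ?h (g div p) \<noteq> 0"
      then have "?h (g mod p) \<noteq> 0"
        using hp0 by (simp flip: eq)
      then have "g mod p \<noteq> 0" by auto
      moreover have "p \<noteq> 0" using hp0 by auto
      ultimately have "degree (g mod p) < degree p"
        using degree_mod_less[of p g] by simp
      moreover have "degree (?h (g mod p)) \<ge> degree (?h p)"
        using nz hp0 by (simp add: degree_mult_eq flip: eq)
      ultimately show False by (simp add: deg)
    qed
    then show ?thesis by auto
  qed
qed

lemma map_poly_cyclotomic: "map_poly of_rat (cyclotomic n) = complex_cyclotomic n"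
proof -
  have "\<exists>!p. map_poly of_rat p = complex_cyclotomic n"
    using complex_cyclotomic_rational[of n] by (metis map_poly_of_rat_inject)
  then show ?thesis
    unfolding cyclotomic_def by (rule theI')
qed


section \<open>The degenerate case \<open>n = 1\<close>\<close>

text \<open>
  For \<open>n = 1\<close> the double sum is \<open>1\<close> and the claimed congruence would read
  \<open>1 \<equiv> q\<close> modulo \<open>(q - 1)\<^sup>2\<close>, which is false.
  The theorem is therefore stated for odd \<open>n > 1\<close>.
\<close>

lemma complex_cyclotomic_1: "complex_cyclotomic 1 = [:- 1, 1:]"
  by (simp add: complex_cyclotomic_def)

lemma cyclotomic_1: "cyclotomic 1 = [:- 1, 1:]"
proof -
  have "map_poly of_rat (cyclotomic 1) = (map_poly of_rat [:- 1, 1:] :: complex poly)"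
    unfolding map_poly_cyclotomic complex_cyclotomic_1 by (simp add: map_poly_pCons)
  then show ?thesis by (simp only: map_poly_of_rat_inject)
qed

lemma not_ratfun_cong_1:
  "\<not> ratfun_cong
       (\<Sum>k = 0..1 - 1. \<Sum>j = 0..k. cq (to_fract indet) j * cq (to_fract indet) (k - j))
       (to_fract (indet * (qint indet 1)\<^sup>2))
       (qint indet 1 * (cyclotomic 1)\<^sup>2)"
proof
  let ?P = "[:- 1, 1 :: rat:]"
  assume "ratfun_cong
       (\<Sum>k = 0..1 - 1. \<Sum>j = 0..k. cq (to_fract indet) j * cq (to_fract indet) (k - j))
       (to_fract (indet * (qint indet 1)\<^sup>2))
       (qint indet 1 * (cyclotomic 1)\<^sup>2)"
  moreover have "to_fract 1 - to_fract indet = to_fract (- ?P)"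
    by (simp only: to_fract_diff [symmetric]) (simp add: indet_def one_pCons)
  moreover have "cq x 0 = 1" for x :: "rat poly fract"
    by (simp add: cq_def qpoch_def qint_def binomial_eq_0)
  ultimately obtain U V where V: "V \<noteq> 0" "coprime V (?P\<^sup>2)"
    and eq: "to_fract (- ?P) = to_fract (?P\<^sup>2) * (to_fract U / to_fract V)"
    unfolding ratfun_cong_def cyclotomic_1
    by (auto simp: qint_def)
  from eq V have "to_fract (- ?P * V) = to_fract (?P\<^sup>2 * U)"
    by (simp add: field_simps del: mult_pCons_left mult_pCons_right flip: to_fract_mult)
  then have "?P * (- V) = ?P * (?P * U)"
    by (simp only: to_fract_eq_iff power2_eq_square mult_minus_left mult_minus_right mult.assoc)
  then have "- V = ?P * U"
    by (subst (asm) mult_cancel_left) simp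
  then have "?P dvd V"
    by (metis dvd_minus_iff dvd_triv_left)
  moreover have "?P dvd ?P\<^sup>2" by simp
  ultimately have "?P dvd 1"
    using V(2) coprime_common_divisor by blast
  then show False
    by (simp add: is_unit_iff_degree)
qed

end

theory Submission
  imports Defs "HOL-Computational_Algebra.Field_as_Ring"
begin

text \<open>
  Modulo a power of \<open>\<Phi>\<^sub>d(q)\<close> one works in the ring of rational functions whose denominator is
  coprime to \<open>\<Phi>\<^sub>d(q)\<close>. Modulo \<open>\<Phi>\<^sub>n(q)\<^sup>2\<close>, the factors \<open>(q;q\<^sup>2)\<^sub>k\<^sup>2\<close> and \<open>(q;q)\<^sub>k\<^sup>2\<close> of \<open>c\<^sub>q(k)\<close> may be
  replaced by \<open>(xq, q/x; q\<^sup>2)\<^sub>k\<close> and \<open>(xq, q/x; q)\<^sub>k\<close> with \<open>x = q\<^sup>n\<close>, after which the sum over \<open>k\<close>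
  terminates and is evaluated by a \<open>q\<close>-WZ pair; this gives \<open>\<Sum>\<^sub>k c\<^sub>q(k) \<equiv> q\<^bsup>(1-n)/2\<^esup>[n]\<close>.
  As \<open>c\<^sub>q(k)\<close> vanishes modulo \<open>\<Phi>\<^sub>n(q)\<^sup>3\<close> for \<open>n/2 < k < n\<close>, the triangular double sum is the square of
  the single sum modulo \<open>\<Phi>\<^sub>n(q)\<^sup>3\<close>. For a proper divisor \<open>d\<close> of \<open>n\<close>, the congruence
  \<open>c\<^sub>q(md + r) \<equiv> \<gamma>\<^sub>m c\<^sub>q(r)\<close> modulo \<open>\<Phi>\<^sub>d(q)\<close> cuts the triangle into \<open>d \<times> d\<close> blocks, each of which
  contains the vanishing factor \<open>\<Sum>\<^sub>r\<^sub><\<^sub>d c\<^sub>q(r)\<close>. The moduli are pairwise coprime and multiply up to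
  \<open>[n]\<Phi>\<^sub>n(q)\<^sup>2\<close>.
\<close>

section \<open>A terminating \<open>q\<close>-series\<close>

text \<open>At \<open>x = 1\<close> this is \<open>(1 - q) * cq q k\<close>, so \<open>x\<close>
  deforms the summand. The symmetry between \<open>x\<close> and \<open>1 / x\<close> makes the
  deformation one of second order at \<open>x = 1\<close>. For \<open>x = q ^ (2 * M + 1)\<close>
  the factor \<open>qpoch (q / x) (q\<^sup>2) k\<close> vanishes once \<open>k > M\<close>.\<close>

definition wz :: "'a::field \<Rightarrow> 'a \<Rightarrow> nat \<Rightarrow> 'a" where
  "wz q x k = (1 - q ^ (3 * k + 1)) * (qpoch (x * q) (q\<^sup>2) k * qpoch (q / x) (q\<^sup>2) k * qpoch q (q\<^sup>2) k) /
     (qpoch (q\<^sup>2) (q\<^sup>2) k * (qpoch (x * q) q k * qpoch (q / x) q k) * q ^ ((k + 1) choose 2))"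

section \<open>Shift rules for \<open>q\<close>-shifted factorials\<close>

lemma qpoch_0 [simp]: "qpoch x q 0 = 1"
  by (simp add: qpoch_def)

lemma qpoch_Suc: "qpoch x q (Suc k) = qpoch x q k * (1 - x * q ^ k)"
  by (simp add: qpoch_def)

text \<open>Both sides are the product of \<open>k + 1\<close> factors starting at
  \<open>1 - x\<close>, with the first or the last factor split off. The changes of \<open>x\<close>
  in \<open>wz_shift\<close> reduce to this.\<close>

lemma qpoch_shift: "(1 - x) * qpoch (x * q) q k = qpoch x q k * (1 - x * q ^ k)"
proof (induction k)
  case (Suc k)
  have "(1 - x) * qpoch (x * q) q (Suc k) = ((1 - x) * qpoch (x * q) q k) * (1 - x * q ^ Suc k)"
    by (simp add: qpoch_Suc mult_ac)
  then show ?case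
    unfolding Suc.IH by (simp add: qpoch_Suc mult_ac)
qed simp

lemma qpoch_shift_div:
  fixes x :: "'a::field"
  assumes "x \<noteq> 1"
  shows "qpoch (x * q) q k = qpoch x q k * (1 - x * q ^ k) / (1 - x)"
  using qpoch_shift[of x q k] assms by (simp add: field_simps)

lemma qpoch_shift_div':
  fixes x :: "'a::field"
  assumes "x * q ^ k \<noteq> 1"
  shows "qpoch x q k = (1 - x) * qpoch (x * q) q k / (1 - x * q ^ k)"
  using qpoch_shift[of x q k] assms by (simp add: field_simps)

lemma qpoch_nonzero:
  fixes x :: "'a::field"
  assumes "\<And>i. i < k \<Longrightarrow> x * q ^ i \<noteq> 1"
  shows "qpoch x q k \<noteq> 0"
  using assms by (force simp: qpoch_def)

text \<open>The summand is hypergeometric: the ratio of neighbours is rational in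
  \<open>q ^ k\<close>. The factor \<open>1 - q ^ (3 * k + 1)\<close> of the old term has to be
  cancelled, whence the assumption.\<close>

lemma wz_Suc:
  fixes q x :: "'a::field"
  assumes "1 - q ^ (3 * k + 1) \<noteq> 0"
  shows "wz q x (Suc k) = wz q x k *
     ((1 - q ^ (3 * k + 4)) * (1 - x * q ^ (2 * k + 1)) * (1 - q / x * q ^ (2 * k)) * (1 - q ^ (2 * k + 1))) /
     ((1 - q ^ (3 * k + 1)) * (1 - q ^ (2 * k + 2)) * (1 - x * q ^ (k + 1)) * (1 - q / x * q ^ k) * q ^ (k + 1))"
proof -
  have c: "Suc (k + 1) choose 2 = ((k + 1) choose 2) + (k + 1)"
    by (simp add: numeral_2_eq_2)
  have s: "3 * Suc k + 1 = 3 * k + 4" "Suc k + 1 = Suc (k + 1)" by simp_all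
  have p: "(q\<^sup>2) ^ k = q ^ (2 * k)" "1 - x * q * q ^ (2 * k) = 1 - x * q ^ (2 * k + 1)"
    "1 - q\<^sup>2 * q ^ (2 * k) = 1 - q ^ (2 * k + 2)" "1 - x * q * q ^ k = 1 - x * q ^ (k + 1)"
    "1 - q * q ^ (2 * k) = 1 - q ^ (2 * k + 1)"
    by (simp_all add: power_mult power_add power2_eq_square power_mult_distrib mult_ac)
  \<comment> \<open>Only \<open>u\<close> is really cancelled; the rest is regrouping, which stays
    true when division by zero gives zero.\<close>
  have gen: "u' * (a * a' * (b * b') * (c * c')) / (d * d' * ((e * e') * (f * f')) * (g * g')) =
     (u * (a * b * c) / (d * (e * f) * g)) * (u' * a' * b' * c') / (u * d' * e' * f' * g')"
     if "u \<noteq> 0" for u u' a a' b b' c c' d d' e e' f f' g g' :: 'a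
    using that by (simp add: divide_simps)
  show ?thesis
    unfolding wz_def qpoch_Suc s c power_add[of q "(k + 1) choose 2"] p
    by (rule gen[OF assms])
qed

text \<open>Multiplying \<open>x\<close> by \<open>q\<^sup>2\<close> moves each symbol in base
  \<open>q\<^sup>2\<close> by one step and each symbol in base \<open>q\<close> by two, in opposite
  directions for \<open>x * q\<close> and \<open>q / x\<close>. Only boundary factors survive, which
  gives the second ratio required for a WZ pair.\<close>

lemma wz_shift:
  fixes q x :: "'a::field"
  assumes "x \<noteq> 0" "q \<noteq> 0" "x \<noteq> 1" "q * x \<noteq> 1" and xq: "\<And>i. x * q ^ i \<noteq> 1"
    and "q * x \<noteq> q ^ (2 * k)" "x \<noteq> q ^ k" "q * x \<noteq> q ^ k"
  shows "wz q (x * q\<^sup>2) k = wz q x k *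
     ((1 - x * q ^ (2 * k + 1)) * (1 - x * q\<^sup>2) * (q * x - q ^ k) * (x - q ^ k)) /
     ((q * x - q ^ (2 * k)) * (1 - x * q ^ (k + 1)) * (1 - x * q ^ (k + 2)) * (x - 1))"
proof -
  have nz: "x * q \<noteq> 1" "x * q * q \<noteq> 1" "x * q * q ^ k \<noteq> 1" "x * (q * q ^ k) \<noteq> 1"  "x * (q * (q * q ^ k)) \<noteq> 1"
    using xq[of 1] xq[of 2] xq[of "k + 1"] xq[of "k+2"] by (simp_all add: power2_eq_square mult_ac)
  define Q where "Q = q ^ k"
  have e: "x * q\<^sup>2 * q = (x * q) * q\<^sup>2" "q / (x * q\<^sup>2) = 1 / (x * q)" 
     "x * q * q\<^sup>2 = x * q * q * q"
    using \<open>q \<noteq> 0\<close> by (simp_all add: power2_eq_square)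
  have a: "qpoch (x * q * q\<^sup>2) (q\<^sup>2) k = qpoch (x * q) (q\<^sup>2) k * (1 - x * q * Q\<^sup>2) / (1 - x * q)"
    using nz by (subst qpoch_shift_div) (simp_all add: Q_def flip: power_mult mult.commute[of 2])
  have b: "qpoch (1 / (x * q)) (q\<^sup>2) k = (1 - 1 / (x * q)) * qpoch (q / x) (q\<^sup>2) k / (1 - 1 / (x * q) * Q\<^sup>2)"
    using assms by (subst qpoch_shift_div')
      (auto simp: Q_def power2_eq_square power_mult power_mult_distrib field_simps simp flip: power_add)
  have c: "qpoch (x * q * q\<^sup>2) q k = qpoch (x * q) q k * (1 - x * q * Q) * (1 - x * q * q * Q) / ((1 - x * q) * (1 - x * q * q))"
    unfolding e(3)
    using nz by (simp add: qpoch_shift_div Q_def)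
  have d: "qpoch (1 / x) q k * (1 - Q / x) = (1 - 1 / x) * qpoch (q / x) q k"
    "qpoch (1 / (x * q)) q k * (1 - Q / (x * q)) = (1 - 1 / (x * q)) * qpoch (1 / x) q k"
    using qpoch_shift[of "1/x" q k] qpoch_shift[of "1/(x*q)" q k] \<open>q \<noteq> 0\<close>
    by (simp_all add: Q_def)
  have d: "qpoch (1 / (x * q)) q k = (1 - 1 / (x * q)) * (1 - 1 / x) * qpoch (q / x) q k / ((1 - Q / x) * (1 - Q / (x * q)))"
  proof -
    have "1 - Q / x \<noteq> 0" "1 - Q / (x * q) \<noteq> 0"
      using assms by (auto simp: Q_def mult_ac)
    moreover have "qpoch (1 / (x * q)) q k * (1 - Q / (x * q)) * (1 - Q / x) =
        (1 - 1 / (x * q)) * (qpoch (1 / x) q k * (1 - Q / x))"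
      unfolding d(2) by (simp only: mult_ac)
    ultimately show ?thesis
      unfolding d(1) by (simp add: eq_divide_eq mult_ac)
  qed
  have gen: "u * (A * A' / A'' * (B'' * B / B') * C) / (D * (E * E' * E'' / E0 * (F' * F'' * F / (G' * G''))) * H) = 
       (u * (A * B * C) / (D * (E * F) * H)) * (A' * B'' * E0 * (G' * G'') / (A'' * B' * E' * E'' * (F' * F'')))"
      for A A' A'' B B' B'' C D E E' E'' E0 F F' F'' G' G'' H u :: 'a
    by (simp add: field_simps)
  have f: "1 - Q / x = (x - Q) / x" "1 - Q / (x * q) = (q * x - Q) / (x * q)"
    "1 - 1 / (x * q) * Q\<^sup>2 = (q * x - Q\<^sup>2) / (x * q)" "1 - 1 / x = (x - 1) / x"
    "1 - 1 / (x * q) = (q * x - 1) / (x * q)"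
    using \<open>x \<noteq> 0\<close> \<open>q \<noteq> 0\<close> by (simp_all add: field_simps)
  have g: "q ^ k = Q" "q ^ (2 * k) = Q\<^sup>2" "x * q ^ (2 * k + 1) = x * q * Q\<^sup>2"
     "x * q ^ (k + 1) = x * q * Q" "x * q ^ (k + 2) = x * q * q * Q"
    by (simp_all add: Q_def power_mult power_add power2_eq_square power_mult_distrib mult_ac)
  have h: "(A * (e / (x * q)) * (N1 * N2) * ((s / x) * (t / (x * q)))) / 
      (N1 * (w / (x * q)) * U * V * ((e / (x * q)) * (z / x))) = A * N2 * t * s / (w * U * V * z)"
    if "N1 \<noteq> 0" "e \<noteq> 0" for A e N1 N2 s t w U V z :: 'a
    using that \<open>x \<noteq> 0\<close> \<open>q \<noteq> 0\<close> by (simp add: divide_simps)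
  have "1 - x * q \<noteq> 0" "q * x - 1 \<noteq> 0"
    using assms nz by auto
  then have "wz q (x * q\<^sup>2) k = wz q x k * ((1 - x * q * Q\<^sup>2) * (1 - x * q * q) * (q * x - Q) * (x - Q) /
     ((q * x - Q\<^sup>2) * (1 - x * q * Q) * (1 - x * q * q * Q) * (x - 1)))"
    unfolding wz_def e(1,2) a b c d gen f by (subst h) (auto simp: mult_ac)
  then show ?thesis
    unfolding g times_divide_eq_right by (simp only: power2_eq_square mult.assoc)
qed

text \<open>
  The certificate equation of the WZ pair, cleared of denominators, with \<open>Q = q\<^sup>k\<close>. The substitution
  \<open>x \<mapsto> q\<^sup>2x\<close> plays the role of the shift \<open>M \<mapsto> M + 1\<close> for \<open>x = q\<^sup>2\<^sup>M\<^sup>+\<^sup>1\<close>.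
\<close>

lemma wz_identity:
  fixes q Q x :: "'a::field"
  shows "(1 - q * Q ^ 3) * (- q * (1 - x * q * Q\<^sup>2) * (q * x - Q) * (x - Q)
            - (q * x - Q\<^sup>2) * (1 - x * q * Q) * (1 - x * q\<^sup>2 * Q)) =
         (1 - x * q * Q\<^sup>2) * (1 - q * Q\<^sup>2) * (q * Q - 1) * (1 + q * x) * (q * x - Q\<^sup>2)
            - q * (1 - Q\<^sup>2) * Q * (Q - 1) * (1 + q * x) * (x - Q) * (1 - x * q\<^sup>2 * Q)"
  by algebra

text \<open>
  Telescoping must stop at \<open>K \<le> M\<close>: for \<open>x = q\<^sup>2\<^sup>M\<^sup>+\<^sup>1\<close> the factor \<open>qx - q\<^sup>2\<^sup>k\<close> in the denominator of
  the certificate vanishes at \<open>k = M + 1\<close>.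
\<close>

lemma wz_partial_sum:
  fixes q x :: "'a::field"
  assumes "x \<noteq> 0" "q \<noteq> 0" "x \<noteq> 1" "q * x \<noteq> 1" and xq: "\<And>i. x * q ^ i \<noteq> 1"
    and q: "\<And>i. i > 0 \<Longrightarrow> q ^ i \<noteq> 1"
    and "\<And>k. k \<le> K \<Longrightarrow> q * x \<noteq> q ^ (2 * k) \<and> x \<noteq> q ^ k \<and> q * x \<noteq> q ^ k"
  shows "(\<Sum>k\<le>K. q * wz q (x * q\<^sup>2) k / (1 - x * q\<^sup>2) - wz q x k / (1 - x)) =
     wz q x K / (1 - x) * ((1 - x * q ^ (2 * K + 1)) * (1 - q ^ (2 * K + 1)) * (q ^ (K + 1) - 1) * (1 + q * x) /
       ((1 - x * q ^ (K + 1)) * (1 - x * q ^ (K + 2)) * (1 - q ^ (3 * K + 1))))"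
  using assms(7)
proof (induction K)
  case 0
  have "1 - x \<noteq> 0" "1 - x * q\<^sup>2 \<noteq> 0" "1 - q \<noteq> 0" "1 - x * q \<noteq> 0"
    using \<open>x \<noteq> 1\<close> xq[of 1] xq[of 2] q[of 1] by auto
  then show ?case
    by (simp add: wz_def binomial_eq_0 divide_simps) algebra
next
  case (Suc K)
  define Q where "Q = q ^ Suc K"
  have g: "q ^ Suc K = Q" "q ^ (K + 1) = Q" "q ^ (2 * Suc K) = Q\<^sup>2" "x * q ^ (2 * Suc K + 1) = x * q * Q\<^sup>2"
     "x * q ^ (Suc K + 1) = x * q * Q" "x * q ^ (Suc K + 2) = x * q\<^sup>2 * Q" "q ^ (2 * Suc K + 1) = q * Q\<^sup>2"
     "q ^ (3 * Suc K + 1) = q * Q ^ 3" "q ^ (Suc K + 1) = q * Q" "q ^ (3 * K + 4) = q * Q ^ 3"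
     "q ^ (2 * K + 2) = Q\<^sup>2" "x * q ^ (K + 1) = x * Q" "x * q ^ (K + 2) = x * q * Q"
    by (simp_all add: Q_def power_mult power_add power2_eq_square power3_eq_cube power_mult_distrib mult_ac
        numeral_eq_Suc)
  have h: "q / x * q ^ (2 * K) = Q\<^sup>2 / (q * x)" "q / x * q ^ K = Q / x"
    using \<open>q \<noteq> 0\<close> by (simp_all add: Q_def power2_eq_square mult_2 power_add)
  have nz: "1 - x \<noteq> 0" "1 - x * q\<^sup>2 \<noteq> 0" "1 - q * Q ^ 3 \<noteq> 0" "1 - Q\<^sup>2 \<noteq> 0" "1 - x * Q \<noteq> 0"
    "1 - x * q * Q \<noteq> 0" "1 - x * q\<^sup>2 * Q \<noteq> 0" "1 - q ^ (2 * K + 1) \<noteq> 0" "1 - q ^ (3 * K + 1) \<noteq> 0"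
    "1 - x * q ^ (2 * K + 1) \<noteq> 0"
    using \<open>x \<noteq> 1\<close> xq[of 2] q[of "3 * K + 4"] q[of "2 * K + 2"] xq[of "K+1"] xq[of "K+2"] xq[of "Suc K+2"] 
      q[of "2 * K + 1"] q[of "3 * K + 1"] xq[of "2 * K + 1"] by (simp_all only: g) auto
  have nz2: "q * x - Q\<^sup>2 \<noteq> 0" "x - Q \<noteq> 0" "Q \<noteq> 0"
    using Suc.prems[of "Suc K", unfolded g] \<open>q \<noteq> 0\<close> by (simp_all add: Q_def)
  define w where "w = wz q x (Suc K)"
  define u where "u = wz q x K"
  have w: "w = u * ((1 - q * Q ^ 3) * (1 - x * q ^ (2 * K + 1)) * (1 - Q\<^sup>2 / (q * x)) * (1 - q ^ (2 * K + 1))) /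
     ((1 - q ^ (3 * K + 1)) * (1 - Q\<^sup>2) * (1 - x * Q) * (1 - Q / x) * Q)"
    using nz unfolding w_def u_def by (subst wz_Suc) (simp_all only: g h, simp)
  \<comment> \<open>The boundary term at \<open>K\<close> is rewritten through
    \<open>wz q x (Suc K)\<close> by means of \<open>wz_Suc\<close>, so that everything in the
    inductive step becomes a multiple of \<open>w / (1 - x)\<close>.\<close>
  have G: "u / (1 - x) * ((1 - x * q ^ (2 * K + 1)) * (1 - q ^ (2 * K + 1)) * (Q - 1) * (1 + q * x) /
       ((1 - x * Q) * (1 - x * q * Q) * (1 - q ^ (3 * K + 1)))) = 
     w / (1 - x) * (q * (1 - Q\<^sup>2) * Q * (Q - 1) * (1 + q * x) * (x - Q) / ((1 - q * Q ^ 3) * (q * x - Q\<^sup>2) * (1 - x * q * Q)))"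
  proof -
    have k: "1 - Q\<^sup>2 / (q * x) = (q * x - Q\<^sup>2) / (q * x)" "1 - Q / x = (x - Q) / x"
      using \<open>x \<noteq> 0\<close> \<open>q \<noteq> 0\<close> by (simp_all add: field_simps)
    have *: "u / x1 * (a1 * a2 * a3 * a4 / (b1 * b2 * b3)) = (u * (c1 * a1 * (c2 / (q * x)) * a2) /
       (b3 * d1 * b1 * (d2 / x) * Q)) / x1 * (q * d1 * Q * a3 * a4 * d2 / (c1 * c2 * b2))" 
       if "c1 \<noteq> 0" "c2 \<noteq> 0" "d1 \<noteq> 0" "d2 \<noteq> 0"
       for x1 a1 a2 a3 a4 b1 b2 b3 c1 c2 d1 d2
       using that \<open>x \<noteq> 0\<close> \<open>q \<noteq> 0\<close> nz2 by (simp add: divide_simps)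
    show ?thesis
      unfolding w k by (rule *) (use nz nz2 in auto)
  qed
  have "(\<Sum>k\<le>K. q * wz q (x * q\<^sup>2) k / (1 - x * q\<^sup>2) - wz q x k / (1 - x)) =
     u / (1 - x) * ((1 - x * q ^ (2 * K + 1)) * (1 - q ^ (2 * K + 1)) * (Q - 1) * (1 + q * x) /
       ((1 - x * Q) * (1 - x * q * Q) * (1 - q ^ (3 * K + 1))))"
    unfolding u_def g(13) [symmetric] unfolding g(2) [symmetric] by (rule Suc.IH) (use Suc.prems in auto)
  note IH = trans[OF this G]
  \<comment> \<open>Once \<open>w / (1 - x)\<close> is taken out, the step is
    \<open>wz_identity\<close> divided by \<open>T * E * U * V\<close>.\<close>
  have fin: "q * (w * (A * y * B * C) / (E * U * V * (x - 1))) / y - w / (1 - x) + w / (1 - x) * (Z * C / (T * E * U)) =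
      w / (1 - x) * (Y / (U * V * T))"
    if "T * (- q * A * B * C - E * U * V) = Y * E - Z * C * V"
      "T \<noteq> 0" "E \<noteq> 0" "U \<noteq> 0" "V \<noteq> 0" "y \<noteq> 0" for A B C E T U V Y Z y
  proof -
    have "1 - x = - (x - 1)" "x - 1 \<noteq> 0" using \<open>x \<noteq> 1\<close> by auto
    have "- (q * A * B * C) / (E * U * V) - 1 + Z * C / (T * E * U) = Y / (U * V * T)"
      using that by (simp add: divide_simps) algebra
    moreover have "q * (w * (A * y * B * C) / (E * U * V * (x - 1))) / y = w / (1 - x) * (- (q * A * B * C) / (E * U * V))"
      using that \<open>x - 1 \<noteq> 0\<close> unfolding \<open>1 - x = - (x - 1)\<close> by (simp add: divide_simps) (simp add: algebra_simps)
    ultimately show ?thesis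
      by (metis (no_types, lifting) distrib_left mult.right_neutral right_diff_distrib)
  qed
  have ws: "wz q (x * q\<^sup>2) (Suc K) = w * ((1 - x * q * Q\<^sup>2) * (1 - x * q\<^sup>2) * (q * x - Q) * (x - Q)) /
     ((q * x - Q\<^sup>2) * (1 - x * q * Q) * (1 - x * q\<^sup>2 * Q) * (x - 1))"
    using wz_shift[of x q "Suc K"] assms(1-4) xq Suc.prems[of "Suc K"] unfolding g w_def by (simp add: mult.assoc)
  have "(\<Sum>k\<le>Suc K. q * wz q (x * q\<^sup>2) k / (1 - x * q\<^sup>2) - wz q x k / (1 - x)) =
     (q * wz q (x * q\<^sup>2) (Suc K) / (1 - x * q\<^sup>2) - w / (1 - x)) +
      w / (1 - x) * (q * (1 - Q\<^sup>2) * Q * (Q - 1) * (1 + q * x) * (x - Q) / ((1 - q * Q ^ 3) * (q * x - Q\<^sup>2) * (1 - x * q * Q)))"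
    unfolding sum.atMost_Suc w_def [symmetric] IH by (rule add.commute)
  also have "\<dots> = w / (1 - x) * ((1 - x * q * Q\<^sup>2) * (1 - q * Q\<^sup>2) * (q * Q - 1) * (1 + q * x) /
       ((1 - x * q * Q) * (1 - x * q\<^sup>2 * Q) * (1 - q * Q ^ 3)))"
    unfolding ws by (rule fin[OF wz_identity]) (use nz nz2 in auto)
  finally show ?case
    unfolding g w_def by (simp only: mult.assoc)
qed

text \<open>Induction on \<open>M\<close>. For \<open>x = q ^ (2 * M + 1)\<close>,
  \<open>wz_partial_sum\<close> links the sums at \<open>x\<close> and at
  \<open>x * q\<^sup>2\<close> over the common range \<open>k \<le> M\<close>. The new sum has one
  more term, \<open>k = Suc M\<close>, which cancels the boundary contribution exactly.\<close>

lemma wz_sum: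
  fixes q :: "'a::field"
  assumes "q \<noteq> 0" and q: "\<And>i. i > 0 \<Longrightarrow> q ^ i \<noteq> 1"
  shows "(\<Sum>k\<le>M. wz q (q ^ (2 * M + 1)) k) = (1 - q ^ (2 * M + 1)) / q ^ M"
proof (induction M)
  case 0
  show ?case by (simp add: wz_def binomial_eq_0)
next
  case (Suc M)
  \<comment> \<open>Powers of \<open>q\<close> are pairwise distinct, so the side conditions of
    \<open>wz_partial_sum\<close> become statements on exponents.\<close>
  have eq_iff: "q ^ i = q ^ j \<longleftrightarrow> i = j" for i j
  proof (induction i j rule: linorder_wlog)
    case (le i j)
    have "q ^ j = q ^ i * q ^ (j - i)" using le by (simp flip: power_add)
    then show ?case using q[of "j - i"] \<open>q \<noteq> 0\<close> le by (cases "i = j") auto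
  qed auto
  define x where "x = q ^ (2 * M + 1)"
  have x2: "q ^ (2 * Suc M + 1) = x * q\<^sup>2" by (simp add: x_def power_add power2_eq_square)
  have conds: "x \<noteq> 0" "x \<noteq> 1" "q * x \<noteq> 1" "\<And>i. x * q ^ i \<noteq> 1"
    "\<And>k. k \<le> M \<Longrightarrow> q * x \<noteq> q ^ (2 * k) \<and> x \<noteq> q ^ k \<and> q * x \<noteq> q ^ k"
  proof -
    show "q * x \<noteq> q ^ (2 * k) \<and> x \<noteq> q ^ k \<and> q * x \<noteq> q ^ k" if "k \<le> M" for k
      unfolding x_def power_Suc [symmetric] eq_iff using that by auto
    show "x * q ^ i \<noteq> 1" for i unfolding x_def power_add [symmetric] by (rule q) simp
    show "q * x \<noteq> 1" unfolding x_def power_Suc [symmetric] by (rule q) simp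
    show "x \<noteq> 1" unfolding x_def by (rule q) simp
    show "x \<noteq> 0" using \<open>q \<noteq> 0\<close> by (simp add: x_def)
  qed
  have sums: "(\<Sum>k\<le>M. q * wz q (x * q\<^sup>2) k / (1 - x * q\<^sup>2) - wz q x k / (1 - x)) =
     wz q x M / (1 - x) * ((1 - x * q ^ (2 * M + 1)) * (1 - q ^ (2 * M + 1)) * (q ^ (M + 1) - 1) * (1 + q * x) /
       ((1 - x * q ^ (M + 1)) * (1 - x * q ^ (M + 2)) * (1 - q ^ (3 * M + 1))))"
    by (rule wz_partial_sum) (use assms conds in auto)
  define P where "P = q ^ M"
  have g: "q ^ (2 * M) = P\<^sup>2" "q ^ (3 * M + 1) = q * P ^ 3" "q ^ M = P" "q ^ (2 * M + 1) = q * P\<^sup>2"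
    "q ^ (M + 1) = q * P" "q ^ (M + 2) = q\<^sup>2 * P" "q ^ (3 * M + 4) = q ^ 4 * P ^ 3" 
    "q ^ (2 * M + 2) = q\<^sup>2 * P\<^sup>2" "q ^ Suc M = q * P" and x: "x = q * P\<^sup>2"
    unfolding P_def x_def
    by (simp_all add: power_mult power_add power2_eq_square power_mult_distrib power3_eq_cube mult_ac
        numeral_eq_Suc)
  have "P \<noteq> 0" using \<open>q \<noteq> 0\<close> by (simp add: P_def)
  have S: "(\<Sum>k\<le>M. wz q x k) = (1 - x) / P"
    using Suc.IH by (simp add: x_def P_def)
  have nz: "1 - q * P ^ 3 \<noteq> 0" "1 - q ^ 4 * P ^ 3 \<noteq> 0" "1 - q\<^sup>2 * P\<^sup>2 \<noteq> 0" "1 - q * P \<noteq> 0" "1 - q\<^sup>2 * P \<noteq> 0"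
    "1 - q * P\<^sup>2 \<noteq> 0" "1 - q\<^sup>2 * P ^ 3 \<noteq> 0" "1 - q ^ 3 * P ^ 3 \<noteq> 0" "1 - q\<^sup>2 \<noteq> 0" "1 - q ^ 3 * P\<^sup>2 \<noteq> 0"
    using q[of "3 * M + 1"] q[of "3 * M + 4"] q[of "2 * M + 2"] q[of "M + 1"] q[of "M + 2"] q[of "2 * M + 1"]
      q[of "3 * M + 2"] q[of "3 * M + 3"] q[of "2"] q[of "2 * M + 3"]
    by (simp_all add: P_def power_mult power_add power2_eq_square power_mult_distrib power3_eq_cube mult_ac
        numeral_eq_Suc)
  have l1: "wz q (x * q\<^sup>2) (Suc M) = wz q (x * q\<^sup>2) M *
     ((1 - q ^ 4 * P ^ 3) * (1 - x * q\<^sup>2 * (q * P\<^sup>2)) * (1 - q / (x * q\<^sup>2) * P\<^sup>2) * (1 - q * P\<^sup>2)) /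
     ((1 - q * P ^ 3) * (1 - q\<^sup>2 * P\<^sup>2) * (1 - x * q\<^sup>2 * (q * P)) * (1 - q / (x * q\<^sup>2) * P) * (q * P))"
    using wz_Suc[of q M "x * q\<^sup>2"] nz(1) unfolding g by simp
  have l2: "wz q (x * q\<^sup>2) M = wz q x M *
     ((1 - x * (q * P\<^sup>2)) * (1 - x * q\<^sup>2) * (q * x - P) * (x - P)) /
     ((q * x - P\<^sup>2) * (1 - x * (q * P)) * (1 - x * (q\<^sup>2 * P)) * (x - 1))"
    using wz_shift[of x q M] conds(1-4) conds(5)[of M] \<open>q \<noteq> 0\<close> unfolding g by simp
  \<comment> \<open>The additional term is reached from \<open>wz q x M\<close> by the shift in
    \<open>x\<close> (\<open>l2\<close>) and then the step in \<open>k\<close>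
    (\<open>l1\<close>).\<close>
  have last: "wz q (x * q\<^sup>2) (Suc M) =
    - ((1 - x * q\<^sup>2) / q) * (wz q x M / (1 - x) * ((1 - x * (q * P\<^sup>2)) * (1 - q * P\<^sup>2) * (q * P - 1) * (1 + q * x) /
       ((1 - x * (q * P)) * (1 - x * (q\<^sup>2 * P)) * (1 - q * P ^ 3))))"
  proof -
    have f: "1 - q / (x * q\<^sup>2) * P\<^sup>2 = (q\<^sup>2 - 1) / q\<^sup>2" "1 - q / (x * q\<^sup>2) * P = (q\<^sup>2 * P - 1) / (q\<^sup>2 * P)"
      "q * x - P = P * (q\<^sup>2 * P - 1)" "x - P = P * (q * P - 1)" "q * x - P\<^sup>2 = P\<^sup>2 * (q\<^sup>2 - 1)"
      "1 - x * q\<^sup>2 * (q * P) = 1 - q ^ 4 * P ^ 3" "x - 1 = - (1 - q * P\<^sup>2)" "1 - x = 1 - q * P\<^sup>2"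
      "1 - x * q\<^sup>2 * (q * P\<^sup>2) = (1 - q\<^sup>2 * P\<^sup>2) * (1 + q * x)"
      using \<open>P \<noteq> 0\<close> \<open>q \<noteq> 0\<close> unfolding x
      by (simp_all add: field_simps power2_eq_square power3_eq_cube numeral_eq_Suc)
    have *: "(w * (a * (1 - x * q\<^sup>2) * (P * b) * (P * c)) / (P\<^sup>2 * d * e * f * - g)) * (h * (i * j) * (d / q\<^sup>2) * g) /
        (k * i * h * (b / (q\<^sup>2 * P)) * (q * P)) =
       - ((1 - x * q\<^sup>2) / q) * (w / g * (a * g * c * j / (e * f * k)))"
      if "b \<noteq> 0" "d \<noteq> 0" "g \<noteq> 0" "h \<noteq> 0" "i \<noteq> 0" for w a b c d e f g h i j k
      using that \<open>P \<noteq> 0\<close> \<open>q \<noteq> 0\<close> by (simp add: divide_simps power2_eq_square)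
    show ?thesis
      unfolding l1 l2 f by (rule *) (use nz in auto)
  qed
  have "(1 - x * q\<^sup>2) \<noteq> 0" "1 - x \<noteq> 0" using nz by (auto simp: x power2_eq_square power3_eq_cube mult_ac)
  have "q * (\<Sum>k\<le>M. wz q (x * q\<^sup>2) k) / (1 - x * q\<^sup>2) - (1 - x) / P / (1 - x) = wz q x M / (1 - x) * ((1 - x * (q * P\<^sup>2)) * (1 - q * P\<^sup>2) * (q * P - 1) * (1 + q * x) /
       ((1 - x * (q * P)) * (1 - x * (q\<^sup>2 * P)) * (1 - q * P ^ 3)))" (is "_ = ?R")
    unfolding S [symmetric] using sums unfolding g by (simp only: sum_subtractf sum_distrib_left sum_divide_distrib)
  moreover have "a = y / q * (1 / P + R)" if "q * a / y - z / P / z = R" "y \<noteq> 0" "z \<noteq> 0" for a y z R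
    using that \<open>P \<noteq> 0\<close> \<open>q \<noteq> 0\<close> by (auto simp: field_simps)
  ultimately have "(\<Sum>k\<le>M. wz q (x * q\<^sup>2) k) = (1 - x * q\<^sup>2) / q * (1 / P + ?R)"
    using \<open>1 - x * q\<^sup>2 \<noteq> 0\<close> \<open>1 - x \<noteq> 0\<close> by blast
  moreover have "y / q * (1 / P + R) + - (y / q) * R = y / (q * P)" for y R
    by (simp add: distrib_left)
  ultimately show ?case
    unfolding x2 sum.atMost_Suc last g by (simp only:)
qed

section \<open>Congruences between rational functions\<close>

text \<open>The localization of the polynomial ring at the polynomials coprime to \<open>P\<close>.
  As a set rather than a type it can vary with the divisor \<open>d\<close> of
  \<open>n\<close>.\<close>

definition local_ring :: "rat poly \<Rightarrow> rat poly fract set" where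
  "local_ring P = {to_fract U / to_fract V | U V. V \<noteq> 0 \<and> coprime V P}"

text \<open>Only the difference is constrained, while \<open>A\<close> and \<open>B\<close> may have
  \<open>P\<close> in the denominator. Hence sums work without integrality assumptions, whereas
  products require them.\<close>

definition lcong :: "rat poly \<Rightarrow> nat \<Rightarrow> rat poly fract \<Rightarrow> rat poly fract \<Rightarrow> bool" where
  "lcong P m A B \<longleftrightarrow> (\<exists>c\<in>local_ring P. A - B = to_fract P ^ m * c)"

section \<open>Closure properties of the localization\<close>

lemma to_fract_power [simp]: "to_fract (x ^ n) = to_fract x ^ n"
  by (induction n) simp_all

lemma local_ring_to_fract [simp, intro]: "to_fract U \<in> local_ring P"
  unfolding local_ring_def by (rule CollectI, rule exI[of _ U], rule exI[of _ 1]) simp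

lemma local_ring_0 [simp, intro]: "0 \<in> local_ring P"
  using local_ring_to_fract[of 0] by simp

lemma local_ring_1 [simp, intro]: "1 \<in> local_ring P"
  using local_ring_to_fract[of 1] by simp

lemma local_ring_add [intro]:
  assumes "A \<in> local_ring P" "B \<in> local_ring P"
  shows "A + B \<in> local_ring P"
proof -
  obtain U V U' V' where "A = to_fract U / to_fract V" "B = to_fract U' / to_fract V'"
    "V \<noteq> 0" "V' \<noteq> 0" "coprime V P" "coprime V' P"
    using assms unfolding local_ring_def by blast
  then have "A + B = to_fract (U * V' + U' * V) / to_fract (V * V')" "V * V' \<noteq> 0" "coprime (V * V') P"
    by (simp_all add: add_frac_eq)
  then show ?thesis
    unfolding local_ring_def by blast
qed

lemma local_ring_mult [intro]:
  assumes "A \<in> local_ring P" "B \<in> local_ring P"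
  shows "A * B \<in> local_ring P"
proof -
  obtain U V U' V' where "A = to_fract U / to_fract V" "B = to_fract U' / to_fract V'"
    "V \<noteq> 0" "V' \<noteq> 0" "coprime V P" "coprime V' P"
    using assms unfolding local_ring_def by blast
  then have "A * B = to_fract (U * U') / to_fract (V * V')" "V * V' \<noteq> 0" "coprime (V * V') P"
    by simp_all
  then show ?thesis
    unfolding local_ring_def by blast
qed

lemma local_ring_uminus [intro]: "A \<in> local_ring P \<Longrightarrow> - A \<in> local_ring P"
  using local_ring_mult[of "to_fract (- 1)" P A] local_ring_to_fract[of "- 1" P]
  by (simp del: local_ring_to_fract)

lemma local_ring_diff [intro]: "A \<in> local_ring P \<Longrightarrow> B \<in> local_ring P \<Longrightarrow> A - B \<in> local_ring P"
  using local_ring_add[of A P "- B"] by auto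

lemma local_ring_power [intro]: "A \<in> local_ring P \<Longrightarrow> A ^ n \<in> local_ring P"
  by (induction n) auto

lemma local_ring_prod [intro]: "(\<And>i. i \<in> S \<Longrightarrow> f i \<in> local_ring P) \<Longrightarrow> prod f S \<in> local_ring P"
  by (induction S rule: infinite_finite_induct) auto

lemma local_ring_sum [intro]: "(\<And>i. i \<in> S \<Longrightarrow> f i \<in> local_ring P) \<Longrightarrow> sum f S \<in> local_ring P"
  by (induction S rule: infinite_finite_induct) auto

lemma local_ring_inverse:
  assumes "coprime V P" "V \<noteq> 0"
  shows "inverse (to_fract V) \<in> local_ring P"
  unfolding local_ring_def by (rule CollectI, rule exI[of _ 1], rule exI[of _ V]) (use assms in \<open>simp add: divide_inverse\<close>)

section \<open>Calculus of congruences modulo \<open>P ^ m\<close>\<close>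

lemma lcong_refl [simp, intro]: "lcong P m A A"
  unfolding lcong_def by (auto intro: bexI[of _ 0])

lemma lcong_sym: "lcong P m A B \<Longrightarrow> lcong P m B A"
  unfolding lcong_def by (metis local_ring_uminus minus_diff_eq mult_minus_right)

lemma lcong_add:
  assumes "lcong P m A B" "lcong P m C D"
  shows "lcong P m (A + C) (B + D)"
proof -
  obtain c d where "c \<in> local_ring P" "d \<in> local_ring P" "A - B = to_fract P ^ m * c" "C - D = to_fract P ^ m * d"
    using assms unfolding lcong_def by blast
  moreover from this have "A + C - (B + D) = to_fract P ^ m * (c + d)"
    by (simp add: algebra_simps)
  ultimately show ?thesis
    unfolding lcong_def by blast
qed

lemma lcong_trans [trans]:
  assumes "lcong P m A B" "lcong P m B C"
  shows "lcong P m A C"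
  using lcong_add[OF assms] unfolding lcong_def by (simp add: algebra_simps)

text \<open>By \<open>A * C - B * D = (A - B) * C + B * (C - D)\<close>, integrality is asked of
  \<open>B\<close> and \<open>C\<close>.\<close>

lemma lcong_mult:
  assumes "lcong P m A B" "lcong P m C D" "B \<in> local_ring P" "C \<in> local_ring P"
  shows "lcong P m (A * C) (B * D)"
proof -
  obtain c d where "c \<in> local_ring P" "d \<in> local_ring P" "A - B = to_fract P ^ m * c" "C - D = to_fract P ^ m * d"
    using assms unfolding lcong_def by blast
  moreover from this have "A * C - B * D = to_fract P ^ m * (c * C + B * d)"
    by (simp add: algebra_simps)
  ultimately show ?thesis
    using assms(3,4) unfolding lcong_def by blast
qed

lemma lcong_scale: "lcong P m A B \<Longrightarrow> C \<in> local_ring P \<Longrightarrow> lcong P m (C * A) (C * B)"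
  unfolding lcong_def by (metis local_ring_mult mult.left_commute right_diff_distrib)

lemma lcong_diff: "lcong P m A B \<Longrightarrow> lcong P m C D \<Longrightarrow> lcong P m (A - C) (B - D)"
  using lcong_add[of P m A B "- 1 * C" "- 1 * D"] lcong_scale[of P m C D "- 1"] by (simp add: local_ring_uminus)

lemma lcong_sum: "(\<And>i. i \<in> S \<Longrightarrow> lcong P m (f i) (g i)) \<Longrightarrow> lcong P m (sum f S) (sum g S)"
  by (induction S rule: infinite_finite_induct) (auto intro: lcong_add)

lemma lcong_prod:
  assumes "\<And>i. i \<in> S \<Longrightarrow> lcong P m (f i) (g i)" "\<And>i. i \<in> S \<Longrightarrow> f i \<in> local_ring P"
    "\<And>i. i \<in> S \<Longrightarrow> g i \<in> local_ring P"
  shows "lcong P m (prod f S) (prod g S)"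
  using assms by (induction S rule: infinite_finite_induct) (auto intro!: lcong_mult)

lemma lcong_power: "lcong P m A B \<Longrightarrow> A \<in> local_ring P \<Longrightarrow> B \<in> local_ring P \<Longrightarrow> lcong P m (A ^ n) (B ^ n)"
  by (induction n) (auto intro!: lcong_mult)

lemma lcong_inverse:
  assumes "lcong P m A B" "inverse A \<in> local_ring P" "inverse B \<in> local_ring P" "A \<noteq> 0" "B \<noteq> 0"
  shows "lcong P m (inverse A) (inverse B)"
proof -
  have "lcong P m (inverse A * inverse B * B) (inverse A * inverse B * A)"
    by (rule lcong_scale[OF lcong_sym]) (use assms in auto)
  then show ?thesis
    using assms(4,5) by (simp add: field_simps)
qed

lemma lcong_mono:
  assumes "lcong P m A B" "k \<le> m"
  shows "lcong P k A B"
proof -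
  obtain c where "c \<in> local_ring P" "A - B = to_fract P ^ m * c"
    using assms unfolding lcong_def by blast
  moreover have "to_fract P ^ m = to_fract P ^ k * to_fract P ^ (m - k)"
    using \<open>k \<le> m\<close> by (simp flip: power_add)
  ultimately show ?thesis
    unfolding lcong_def by (intro bexI[of _ "to_fract P ^ (m - k) * c"]) (auto simp: mult.assoc)
qed

text \<open>Orders of vanishing at \<open>P\<close> add up. This is how the exponent 3 arises from
  factors that vanish to first or second order.\<close>

lemma lcong_0_mult:
  assumes "lcong P m A 0" "lcong P k B 0"
  shows "lcong P (m + k) (A * B) 0"
proof -
  obtain c d where "c \<in> local_ring P" "d \<in> local_ring P" "A = to_fract P ^ m * c" "B = to_fract P ^ k * d"
    using assms unfolding lcong_def by auto
  then show ?thesis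
    unfolding lcong_def by (intro bexI[of _ "c * d"]) (auto simp: power_add mult_ac)
qed

lemma lcong_0_scale: "lcong P m A 0 \<Longrightarrow> C \<in> local_ring P \<Longrightarrow> lcong P m (C * A) 0"
  using lcong_scale[of P m A 0 C] by simp

text \<open>The way back to polynomials: after cross-multiplication the second denominator is
  coprime to \<open>P ^ m\<close>, so \<open>P ^ m\<close> divides \<open>U\<close>. One fixed
  fraction \<open>U / V\<close> can thus be tested against all moduli.\<close>

lemma lcong_0_dvd:
  assumes "lcong P m (to_fract U / to_fract V) 0" "V \<noteq> 0"
  shows "P ^ m dvd U"
proof -
  obtain U' V' where *: "to_fract U / to_fract V = to_fract P ^ m * (to_fract U' / to_fract V')"
    "V' \<noteq> 0" "coprime V' P"
    using assms unfolding lcong_def local_ring_def by auto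
  then have "to_fract (U * V') = to_fract (P ^ m * U' * V)"
    using assms(2) by (simp add: field_simps)
  then have "P ^ m dvd U * V'"
    unfolding to_fract_eq_iff by (simp add: mult.assoc)
  moreover have "coprime (P ^ m) V'"
    using * by (simp add: coprime_commute)
  ultimately show ?thesis
    by (simp add: coprime_dvd_mult_left_iff)
qed

lemma dvd_to_fract_lcong: "P ^ m dvd A - B \<Longrightarrow> lcong P m (to_fract A) (to_fract B)"
  unfolding lcong_def by (metis dvdE local_ring_to_fract to_fract_diff to_fract_mult to_fract_power)

section \<open>Coprimality of cyclotomic polynomials\<close>

text \<open>A common divisor has no complex root, so it is constant by the fundamental theorem of
  algebra.\<close>

lemma coprime_no_common_root:
  fixes p q :: "rat poly"
  assumes "\<And>z :: complex. poly (map_poly of_rat p) z = 0 \<Longrightarrow> poly (map_poly of_rat q) z \<noteq> 0"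
  shows "coprime p q"
proof (rule coprimeI)
  fix c assume "c dvd p" "c dvd q"
  let ?h = "map_poly of_rat :: rat poly \<Rightarrow> complex poly"
  have "poly (?h c) z \<noteq> 0" for z
    using assms[of z] \<open>c dvd p\<close> \<open>c dvd q\<close> by (auto elim!: dvdE simp: map_poly_of_rat_mult)
  then have "constant (poly (?h c))"
    using fundamental_theorem_of_algebra by blast
  then have "degree c = 0"
    by (simp add: constant_degree degree_map_poly)
  moreover have "c \<noteq> 0"
    using \<open>poly (?h c) 0 \<noteq> 0\<close> by auto
  ultimately show "is_unit c"
    by (simp add: is_unit_iff_degree)
qed

text \<open>The roots of \<open>cyclotomic d\<close> are \<open>cis (2 * pi * k / d)\<close> with
  \<open>k\<close> coprime to \<open>d\<close>, so they have order exactly \<open>d\<close>. All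
  coprimality statements below rest on this.\<close>

lemma poly_cyclotomic_root:
  assumes "poly (map_poly of_rat (cyclotomic d)) z = (0 :: complex)" "d > 0"
  shows "z ^ i = 1 \<longleftrightarrow> d dvd i"
proof -
  obtain k where k: "k \<in> totatives d" "z = cis (2 * pi * real k / real d)"
    using assms by (auto simp: map_poly_cyclotomic complex_cyclotomic_def poly_prod)
  have "z ^ i = cis (2 * pi * real (k * i) / real d)"
    by (simp add: k(2) Complex.DeMoivre mult_ac)
  also have "\<dots> = 1 \<longleftrightarrow> d dvd k * i"
  proof
    assume "cis (2 * pi * real (k * i) / real d) = 1"
    then have "cos (2 * pi * real (k * i) / real d) = 1"
      by (metis cis.sel(1) one_complex.sel(1))
    then obtain m :: int where "2 * pi * real (k * i) / real d = m * 2 * pi"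
      by (auto simp: cos_one_2pi_int)
    then have "real_of_int (int (k * i)) = real_of_int (m * int d)"
      using \<open>d > 0\<close> by (simp add: field_simps)
    then have "int (k * i) = m * int d"
      by (simp only: of_int_eq_iff)
    then have "int d dvd int (k * i)"
      by simp
    then show "d dvd k * i"
      by (simp only: int_dvd_int_iff)
  next
    assume "d dvd k * i"
    then obtain m where "k * i = d * m" by blast
    then have "2 * pi * real (k * i) / real d = 2 * pi * real m"
      using \<open>d > 0\<close> by simp
    then show "cis (2 * pi * real (k * i) / real d) = 1"
      by (metis cis_multiple_2pi Ints_of_nat)
  qed
  also have "\<dots> \<longleftrightarrow> d dvd i"
    using k(1) by (metis coprime_commute coprime_dvd_mult_right_iff in_totatives_iff)
  finally show ?thesis .
qed

lemma poly_map_indet_power [simp]: "poly (map_poly of_rat (indet ^ i)) z = (z ^ i :: complex)"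
proof -
  have "map_poly of_rat (indet ^ i) = (map_poly of_rat indet ^ i :: complex poly)"
    by (induction i) (simp_all add: map_poly_of_rat_mult)
  then show ?thesis
    by (simp add: indet_def map_poly_pCons)
qed

lemma map_poly_of_rat_diff:
  "map_poly of_rat (p - q) = (map_poly of_rat p - map_poly of_rat q :: complex poly)"
  by (simp add: poly_eq_iff coeff_map_poly of_rat_diff)

lemma coprime_cyclotomic_1_minus:
  assumes "d > 0" "\<not> d dvd i"
  shows "coprime (1 - indet ^ i) (cyclotomic d)"
  by (rule coprime_no_common_root)
    (use assms poly_cyclotomic_root[of d _ i] in \<open>auto simp: map_poly_of_rat_diff\<close>)

text \<open>A common root \<open>z\<close> has \<open>z ^ (2 * i) = 1\<close>, so its order
  \<open>d\<close>, being odd, divides \<open>i\<close>; then \<open>z ^ i\<close> would be both 1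
  and -1.\<close>

lemma coprime_cyclotomic_1_plus:
  assumes "odd d"
  shows "coprime (1 + indet ^ i) (cyclotomic d)"
proof (rule coprime_no_common_root, rule notI)
  fix z :: complex
  assume *: "poly (map_poly of_rat (1 + indet ^ i)) z = 0" "poly (map_poly of_rat (cyclotomic d)) z = 0"
  then have z: "z ^ i = - 1"
    by (simp add: map_poly_of_rat_add eq_neg_iff_add_eq_0 add.commute)
  have "d > 0" using assms by (rule odd_pos)
  have "z ^ (2 * i) = 1"
    by (simp add: z power_mult mult.commute[of 2])
  then have "d dvd 2 * i"
    using poly_cyclotomic_root[OF *(2) \<open>d > 0\<close>] by blast
  then have "d dvd i"
    using assms by (simp add: coprime_dvd_mult_right_iff)
  then have "z ^ i = 1"
    using poly_cyclotomic_root[OF *(2) \<open>d > 0\<close>] by blast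
  then show False
    using z by simp
qed

lemma coprime_cyclotomic_indet:
  assumes "d > 0"
  shows "coprime (indet ^ i) (cyclotomic d)"
proof (rule coprime_no_common_root, rule notI)
  fix z :: complex
  assume *: "poly (map_poly of_rat (indet ^ i)) z = 0" "poly (map_poly of_rat (cyclotomic d)) z = 0"
  then show False
    using poly_cyclotomic_root[OF *(2) assms, of d] assms by (auto simp: power_0_left)
qed

lemma coprime_cyclotomic:
  assumes "d > 0" "e > 0" "d \<noteq> e"
  shows "coprime (cyclotomic d) (cyclotomic e)"
proof (rule coprime_no_common_root, rule notI)
  fix z :: complex
  assume "poly (map_poly of_rat (cyclotomic d)) z = 0" "poly (map_poly of_rat (cyclotomic e)) z = 0"
  then have "d dvd i \<longleftrightarrow> e dvd i" for i
    using poly_cyclotomic_root[of d z i] poly_cyclotomic_root[of e z i] assms by blast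
  then show False
    using \<open>d \<noteq> e\<close> by (meson dvd_antisym dvd_refl)
qed

section \<open>Cyclotomic factors of \<open>indet ^ n - 1\<close>\<close>

lemma indet_power: "indet ^ n = monom 1 n"
  by (simp add: indet_def monom_altdef)

lemma prod_cyclotomic:
  assumes "n > 0"
  shows "(\<Prod>d | d dvd n. cyclotomic d) = indet ^ n - 1"
proof -
  have "map_poly of_rat (\<Prod>d | d dvd n. cyclotomic d) = (map_poly of_rat (indet ^ n - 1) :: complex poly)"
    using prod_complex_cyclotomic[OF assms]
    by (simp add: map_poly_of_rat_prod map_poly_cyclotomic map_poly_of_rat_diff indet_power map_poly_monom)
  then show ?thesis
    by (simp only: map_poly_of_rat_inject)
qed

lemma cyclotomic_dvd:
  assumes "d > 0" "d dvd i"
  shows "cyclotomic d dvd 1 - indet ^ i"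
proof -
  have "cyclotomic d dvd (\<Prod>e | e dvd i. cyclotomic e)" if "i > 0"
    using assms that by (intro dvd_prodI) (auto simp: finite_divisors_nat)
  then have "cyclotomic d dvd indet ^ i - 1"
    by (cases "i = 0") (simp_all add: prod_cyclotomic)
  then show ?thesis
    by (simp add: dvd_diff_commute)
qed

section \<open>Congruences for \<open>c\<^sub>q(k)\<close>\<close>

abbreviation qf :: "rat poly fract" where
  "qf \<equiv> to_fract indet"

text \<open>This is \<open>cq\<close> without its \<open>q\<close>-integer and its power of
  \<open>q\<close>. Its values at multiples of \<open>d\<close> are the multipliers in
  \<open>cq_periodic\<close>.\<close>

definition qratio :: "'a::field \<Rightarrow> nat \<Rightarrow> 'a" where
  "qratio q k = qpoch q (q\<^sup>2) k ^ 3 / ((qpoch q q k)\<^sup>2 * qpoch (q\<^sup>2) (q\<^sup>2) k)"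

lemma cq_conv_qratio: "cq q k = qint q (3 * k + 1) * qratio q k * inverse (q ^ (Suc k choose 2))"
  by (simp add: cq_def qratio_def power_int_minus divide_inverse mult_ac)

lemma one_minus_mult_qint: "(1 - q) * qint q m = 1 - q ^ m"
  by (simp add: qint_def one_diff_power_eq)

lemma indet_nonzero [simp]: "indet \<noteq> 0"
  by (simp add: indet_def)

lemma qf_power_eq_1_iff [simp]: "qf ^ i = 1 \<longleftrightarrow> i = 0"
proof -
  have "qf ^ i = 1 \<longleftrightarrow> to_fract (indet ^ i) = to_fract 1"
    by simp
  also have "\<dots> \<longleftrightarrow> i = 0"
    unfolding to_fract_eq_iff indet_power by (simp add: monom_eq_1_iff)
  finally show ?thesis .
qed

section \<open>Units of the localization at a cyclotomic polynomial\<close>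

lemma inverse_1_minus_local:
  assumes "d > 0" "\<not> d dvd i"
  shows "inverse (1 - qf ^ i) \<in> local_ring (cyclotomic d)"
proof -
  have "1 - indet ^ i \<noteq> 0"
    using qf_power_eq_1_iff[of i] assms by (metis dvd_0_right eq_iff_diff_eq_0 to_fract_1 to_fract_eq_iff to_fract_power)
  then show ?thesis
    using local_ring_inverse[OF coprime_cyclotomic_1_minus[OF assms]] by simp
qed

lemma inverse_1_plus_local:
  assumes "odd d"
  shows "inverse (1 + qf ^ i) \<in> local_ring (cyclotomic d)"
proof -
  have "poly (1 + indet ^ i) 1 = 2"
    by (simp add: indet_def)
  then have "1 + indet ^ i \<noteq> 0"
    by (metis poly_0 zero_neq_numeral)
  then show ?thesis
    using local_ring_inverse[OF coprime_cyclotomic_1_plus[OF assms]] by simp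
qed

lemma inverse_qf_power_local:
  assumes "d > 0"
  shows "inverse (qf ^ i) \<in> local_ring (cyclotomic d)"
  using local_ring_inverse[OF coprime_cyclotomic_indet[OF assms, of i]] by (simp add: indet_def)

lemma qf_power_local [simp, intro]: "qf ^ i \<in> local_ring P"
  by auto

lemma qf_power_cong_1:
  assumes "d > 0" "d dvd i"
  shows "lcong (cyclotomic d) 1 (qf ^ i) 1"
proof -
  have "cyclotomic d ^ 1 dvd 1 - indet ^ i"
    using cyclotomic_dvd[OF assms] by simp
  from lcong_sym[OF dvd_to_fract_lcong[OF this]] show ?thesis
    by simp
qed

lemma qpoch_local [intro]:
  "x \<in> local_ring P \<Longrightarrow> q \<in> local_ring P \<Longrightarrow> qpoch x q k \<in> local_ring P"
  unfolding qpoch_def by (intro local_ring_prod local_ring_diff local_ring_mult local_ring_power local_ring_1)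

lemma inverse_qpoch_local:
  assumes "\<And>i. i < k \<Longrightarrow> inverse (1 - x * q ^ i) \<in> local_ring P"
  shows "inverse (qpoch x q k) \<in> local_ring P"
  using local_ring_prod[of "{..<k}" "\<lambda>i. inverse (1 - x * q ^ i)" P] assms
  by (simp add: qpoch_def prod_inversef [symmetric] o_def)

lemma qpoch_cong:
  assumes "lcong P m x y" "x \<in> local_ring P" "y \<in> local_ring P" "q \<in> local_ring P"
  shows "lcong P m (qpoch x q k) (qpoch y q k)"
  unfolding qpoch_def
  by (intro lcong_prod lcong_diff lcong_mult lcong_refl local_ring_diff local_ring_mult local_ring_power assms local_ring_1)

section \<open>Integrality of the quotient of shifted factorials\<close>

lemma qpoch_add: "qpoch x q (a + b) = qpoch x q a * qpoch (x * q ^ a) q b"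
  by (induction b) (simp_all add: qpoch_Suc power_add mult_ac)

text \<open>Integrality of the Gaussian binomial coefficient, phrased as divisibility in a
  commutative ring so that for \<open>q = indet\<close> the quotient is a polynomial.\<close>

lemma qpoch_dvd_qpoch_add: "qpoch q q a * qpoch q q b dvd qpoch q q (a + b)"
proof (induction "a + b" arbitrary: a b)
  case (Suc m)
  show ?case
  proof (cases "a = 0 \<or> b = 0")
    case False
    then obtain a' b' where ab: "a = Suc a'" "b = Suc b'"
      by (metis not0_implies_Suc)
    have m: "m = a' + b" "m = a + b'"
      using Suc(2) ab by simp_all
    have "qpoch q q (a + b) = qpoch q q m * (1 - q ^ Suc m)"
      using Suc(2) by (simp add: qpoch_Suc flip: Suc(2))
    \<comment> \<open>The splitting behind the \<open>q\<close>-Pascal rule: one summand supplies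
      the missing last factor of \<open>qpoch q q a\<close>, the other that of
      \<open>qpoch q q b\<close>.\<close>
    also have "1 - q ^ Suc m = (1 - q ^ a) + q ^ a * (1 - q ^ b)"
      using Suc(2) by (simp add: algebra_simps flip: power_add)
    also have "qpoch q q m * \<dots> = qpoch q q m * (1 - q ^ a) + qpoch q q m * (q ^ a * (1 - q ^ b))"
      by (rule distrib_left)
    also have "qpoch q q a * qpoch q q b dvd \<dots>"
    proof (rule dvd_add)
      have "qpoch q q a' * qpoch q q b dvd qpoch q q m"
        unfolding m(1) by (rule Suc(1)[OF m(1)])
      then have "qpoch q q a' * qpoch q q b * (1 - q ^ a) dvd qpoch q q m * (1 - q ^ a)"
        by (rule mult_dvd_mono) simp
      then show "qpoch q q a * qpoch q q b dvd qpoch q q m * (1 - q ^ a)"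
        by (simp add: ab(1) qpoch_Suc mult_ac)
      have "qpoch q q a * qpoch q q b' dvd qpoch q q m"
        unfolding m(2) by (rule Suc(1)[OF m(2)])
      then have "qpoch q q a * qpoch q q b' * (1 - q ^ b) dvd qpoch q q m * (q ^ a * (1 - q ^ b))"
        by (rule mult_dvd_mono) simp
      then show "qpoch q q a * qpoch q q b dvd qpoch q q m * (q ^ a * (1 - q ^ b))"
        by (simp add: ab(2) qpoch_Suc mult_ac)
    qed
    finally show ?thesis .
  qed auto
qed simp

text \<open>The factors \<open>1 - q ^ i\<close> with \<open>1 \<le> i \<le> 2 * k\<close> are
  sorted by the parity of \<open>i\<close>.\<close>

lemma qpoch_double: "qpoch q (q\<^sup>2) k * qpoch (q\<^sup>2) (q\<^sup>2) k = qpoch q q (2 * k)"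
proof (induction k)
  case (Suc k)
  have "qpoch q (q\<^sup>2) (Suc k) * qpoch (q\<^sup>2) (q\<^sup>2) (Suc k) =
      (qpoch q (q\<^sup>2) k * qpoch (q\<^sup>2) (q\<^sup>2) k) * (1 - q * (q\<^sup>2) ^ k) * (1 - q\<^sup>2 * (q\<^sup>2) ^ k)"
    by (simp add: qpoch_Suc mult_ac)
  then show ?case
    unfolding Suc.IH by (simp add: qpoch_Suc power_mult power2_eq_square mult.assoc)
qed simp

lemma qpoch_square: "qpoch (q\<^sup>2) (q\<^sup>2) k = qpoch q q k * qpoch (- q) q k"
proof -
  have "1 - q\<^sup>2 * (q\<^sup>2) ^ i = (1 - q * q ^ i) * (1 - (- q) * q ^ i)" for i
    by (simp add: algebra_simps power2_eq_square power_mult_distrib)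
  then show ?thesis
    by (simp add: qpoch_def prod.distrib)
qed

lemma qpoch_qf_nonzero [simp]: "qpoch qf qf k \<noteq> 0" "qpoch (qf\<^sup>2) (qf\<^sup>2) k \<noteq> 0"
proof -
  show "qpoch qf qf k \<noteq> 0"
    by (rule qpoch_nonzero) (simp flip: power_Suc del: to_fract_power)
  have "qf\<^sup>2 * (qf\<^sup>2) ^ i = qf ^ (2 + 2 * i)" for i
    by (simp add: power_add power_mult power2_eq_square)
  then show "qpoch (qf\<^sup>2) (qf\<^sup>2) k \<noteq> 0"
    by (intro qpoch_nonzero) (simp del: power_Suc add_2_eq_Suc)
qed

text \<open>
  \<open>(q;q\<^sup>2)\<^sub>k / (q;q)\<^sub>k\<close> is the Gaussian binomial coefficient \<open>[2k, k]\<close> divided by \<open>(-q;q)\<^sub>k\<close>, whose factors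
  \<open>1 + q\<^sup>i\<close> have no root of odd order.
\<close>

lemma qratio_local:
  assumes "odd d"
  shows "qratio qf k \<in> local_ring (cyclotomic d)"
proof -
  let ?A = "qpoch qf (qf\<^sup>2) k" and ?B = "qpoch qf qf k" and ?C = "qpoch (qf\<^sup>2) (qf\<^sup>2) k" and ?D = "qpoch (- qf) qf k"
  have poly: "to_fract (qpoch indet indet m) = qpoch qf qf m" for m
    by (induction m) (simp_all add: qpoch_Suc)
  obtain G where "qpoch indet indet (k + k) = qpoch indet indet k * qpoch indet indet k * G"
    using qpoch_dvd_qpoch_add by blast
  then have "to_fract (qpoch indet indet (k + k)) = to_fract (qpoch indet indet k * qpoch indet indet k * G)"
    by (simp only:)
  then have "qpoch qf qf (2 * k) = ?B * ?B * to_fract G"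
    by (simp add: poly mult_2)
  then have "?A * (?B * ?D) = ?B * ?B * to_fract G"
    by (simp flip: qpoch_double qpoch_square)
  moreover have "?D \<noteq> 0"
    using qpoch_qf_nonzero(2)[of k] unfolding qpoch_square by auto
  ultimately have A: "?A = ?B * (to_fract G * inverse ?D)"
    by (simp add: field_simps)
  \<comment> \<open>The denominator is \<open>?B ^ 3 * ?D\<close>, so the cube of fact
    \<open>A\<close> removes \<open>?B\<close> entirely.\<close>
  have "qratio qf k = (to_fract G * inverse ?D) ^ 3 * inverse ?D"
    unfolding qratio_def qpoch_square A using \<open>?D \<noteq> 0\<close> by (simp add: field_simps power3_eq_cube power2_eq_square)
  moreover have "inverse ?D \<in> local_ring (cyclotomic d)"
    by (rule inverse_qpoch_local) (use inverse_1_plus_local[OF assms, of "Suc _"] in simp)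
  ultimately show ?thesis
    by auto
qed

lemma qint_local: "qint qf m \<in> local_ring P"
  unfolding qint_def by (intro local_ring_sum) auto

lemma cq_local: "odd d \<Longrightarrow> cq qf k \<in> local_ring (cyclotomic d)"
  unfolding cq_conv_qratio
  by (intro local_ring_mult qint_local qratio_local inverse_qf_power_local odd_pos)

text \<open>The product \<open>qpoch qf (qf\<^sup>2) k\<close>, which enters \<open>cq\<close>
  cubed, contains the factor \<open>1 - qf ^ n\<close> at index \<open>M = (n - 1) / 2\<close>. The
  denominators are units: for \<open>1 \<le> i \<le> k < n\<close> neither \<open>i\<close> nor,
  \<open>n\<close> being odd, \<open>2 * i\<close> is a multiple of \<open>n\<close>.\<close>

lemma cq_vanish:
  assumes "odd n" "n < 2 * k" "k < n"
  shows "lcong (cyclotomic n) 3 (cq qf k) 0"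
proof -
  let ?L = "local_ring (cyclotomic n)"
  have n: "n > 0" using assms by simp
  obtain M where M: "n = 2 * M + 1" using assms oddE by blast
  have "lcong (cyclotomic n) 1 (1 - qf ^ n) (1 - 1)"
    by (intro lcong_diff lcong_refl qf_power_cong_1[OF n]) simp
  then have "lcong (cyclotomic n) 1 ((\<Prod>i\<in>{..<k} - {M}. 1 - qf * (qf\<^sup>2) ^ i) * (1 - qf ^ n)) 0"
    by (intro lcong_0_scale local_ring_prod local_ring_diff local_ring_mult local_ring_power) auto
  also have "qf ^ n = qf * (qf\<^sup>2) ^ M"
    by (simp add: M power_mult)
  also have "(\<Prod>i\<in>{..<k} - {M}. 1 - qf * (qf\<^sup>2) ^ i) * (1 - qf * (qf\<^sup>2) ^ M) = qpoch qf (qf\<^sup>2) k"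
    unfolding qpoch_def using assms M by (subst prod.remove[of "{..<k}" M]) simp_all
  finally have A: "lcong (cyclotomic n) 1 (qpoch qf (qf\<^sup>2) k) 0" .
  have A3: "lcong (cyclotomic n) 3 (qpoch qf (qf\<^sup>2) k ^ 3) 0"
    using lcong_0_mult[OF A lcong_0_mult[OF A A]] by (simp add: power3_eq_cube numeral_eq_Suc)
  have B: "inverse (qpoch qf qf k) \<in> ?L"
    by (rule inverse_qpoch_local, unfold power_Suc [symmetric], rule inverse_1_minus_local)
      (use assms in \<open>auto dest: dvd_imp_le\<close>)
  have "inverse (1 - qf\<^sup>2 * (qf\<^sup>2) ^ i) \<in> ?L" if "i < k" for i
  proof -
    have "\<not> n dvd 2 * Suc i"
      using assms that by (subst coprime_dvd_mult_right_iff) (auto dest: dvd_imp_le)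
    then have "inverse (1 - qf ^ (2 * Suc i)) \<in> ?L"
      using n by (intro inverse_1_minus_local)
    then show ?thesis
      by (simp add: power_mult power2_eq_square mult.assoc)
  qed
  then have C: "inverse (qpoch (qf\<^sup>2) (qf\<^sup>2) k) \<in> ?L"
    by (rule inverse_qpoch_local)
  have "cq qf k = (qint qf (3 * k + 1) * inverse (qpoch qf qf k) ^ 2 * inverse (qpoch (qf\<^sup>2) (qf\<^sup>2) k) *
      inverse (qf ^ (Suc k choose 2))) * qpoch qf (qf\<^sup>2) k ^ 3"
    unfolding cq_conv_qratio qratio_def by (simp add: divide_inverse mult_ac power_inverse)
  then show ?thesis
    by (simp only:) (intro lcong_0_scale A3 local_ring_mult local_ring_power B C qint_local inverse_qf_power_local n)
qed

text \<open>With \<open>x = qf ^ n\<close> the difference of the two sides is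
  \<open>- Y * (x - 1)\<^sup>2 / x\<close>, and \<open>x - 1\<close> is divisible by \<Phi>_n. The
  symmetry in \<open>x\<close> and \<open>1 / x\<close> lifts the congruence to second
  order.\<close>

lemma one_minus_pair_cong:
  assumes "n > 0" "Y \<in> local_ring (cyclotomic n)"
  shows "lcong (cyclotomic n) 2 ((1 - qf ^ n * Y) * (1 - Y / qf ^ n)) ((1 - Y)\<^sup>2)"
proof -
  have "lcong (cyclotomic n) 1 (qf ^ n - 1) (1 - 1)"
    by (intro lcong_diff lcong_refl qf_power_cong_1 assms) simp
  then have "lcong (cyclotomic n) (1 + 1) ((qf ^ n - 1) * (qf ^ n - 1)) 0"
    by (intro lcong_0_mult) simp_all
  then have "lcong (cyclotomic n) 2 ((qf ^ n - 1) * (qf ^ n - 1)) 0"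
    by (simp add: numeral_2_eq_2)
  then have "lcong (cyclotomic n) 2 (- Y * inverse (qf ^ n) * ((qf ^ n - 1) * (qf ^ n - 1))) 0"
    by (rule lcong_0_scale) (intro local_ring_mult local_ring_uminus inverse_qf_power_local assms)
  then have "lcong (cyclotomic n) 2 (- Y * inverse (qf ^ n) * ((qf ^ n - 1) * (qf ^ n - 1)) + (1 - Y)\<^sup>2) (0 + (1 - Y)\<^sup>2)"
    by (rule lcong_add) simp
  moreover have "- Y * inverse x * ((x - 1) * (x - 1)) + (1 - Y)\<^sup>2 = (1 - x * Y) * (1 - Y / x)" if "x \<noteq> 0" for x
    using that by (simp add: field_simps power2_eq_square)
  ultimately show ?thesis
    by simp
qed

lemma qpoch_pair_cong:
  assumes "n > 0" "y \<in> local_ring (cyclotomic n)" "p \<in> local_ring (cyclotomic n)"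
  shows "lcong (cyclotomic n) 2 (qpoch (qf ^ n * y) p k * qpoch (y / qf ^ n) p k) ((qpoch y p k)\<^sup>2)"
proof -
  have L: "Y / qf ^ n \<in> local_ring (cyclotomic n)" if "Y \<in> local_ring (cyclotomic n)" for Y
    unfolding divide_inverse by (intro local_ring_mult that inverse_qf_power_local assms)
  have "lcong (cyclotomic n) 2 (\<Prod>i<k. (1 - qf ^ n * (y * p ^ i)) * (1 - (y * p ^ i) / qf ^ n)) (\<Prod>i<k. (1 - y * p ^ i)\<^sup>2)"
    by (intro lcong_prod one_minus_pair_cong local_ring_mult local_ring_diff local_ring_power assms local_ring_1 L) simp_all
  then show ?thesis
    by (simp add: qpoch_def prod.distrib prod_power_distrib mult_ac)
qed

lemma inverse_qpoch_square_local:
  assumes "odd d" "\<And>i. i < k \<Longrightarrow> \<not> d dvd a + Suc i"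
  shows "inverse (qpoch (qf\<^sup>2 * qf ^ (2 * a)) (qf\<^sup>2) k) \<in> local_ring (cyclotomic d)"
proof (rule inverse_qpoch_local)
  fix i assume "i < k"
  then have "\<not> d dvd 2 * (a + Suc i)"
    using assms by (subst coprime_dvd_mult_right_iff) auto
  then have "inverse (1 - qf ^ (2 * (a + Suc i))) \<in> local_ring (cyclotomic d)"
    using odd_pos[OF assms(1)] by (intro inverse_1_minus_local)
  then show "inverse (1 - qf\<^sup>2 * qf ^ (2 * a) * (qf\<^sup>2) ^ i) \<in> local_ring (cyclotomic d)"
    by (simp add: power_mult power_add power2_eq_square power_mult_distrib mult_ac)
qed

lemma inverse_qpoch_qf_local:
  assumes "d > 0" "\<And>i. i < k \<Longrightarrow> \<not> d dvd a + Suc i"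
  shows "inverse (qpoch (qf * qf ^ a) qf k) \<in> local_ring (cyclotomic d)"
proof (rule inverse_qpoch_local)
  fix i assume "i < k"
  then have "inverse (1 - qf ^ (a + Suc i)) \<in> local_ring (cyclotomic d)"
    using assms by (intro inverse_1_minus_local) auto
  then show "inverse (1 - qf * qf ^ a * qf ^ i) \<in> local_ring (cyclotomic d)"
    by (simp add: power_add mult_ac)
qed

text \<open>Two squares in \<open>cq\<close> are replaced by pairs of factorials at
  \<open>x = qf ^ n\<close>. Up to \<open>k = M\<close> all denominators are units at \<Phi>_n, so
  the quotients are congruent as well.\<close>

lemma cq_cong_wz:
  assumes "n = 2 * M + 1" "k \<le> M"
  shows "lcong (cyclotomic n) 2 ((1 - qf) * cq qf k) (wz qf (qf ^ n) k)"
proof -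
  let ?L = "local_ring (cyclotomic n)" and ?x = "qf ^ n"
  let ?A = "qpoch qf (qf\<^sup>2) k" and ?B = "qpoch qf qf k" and ?C = "qpoch (qf\<^sup>2) (qf\<^sup>2) k"
  let ?A' = "qpoch (?x * qf) (qf\<^sup>2) k * qpoch (qf / ?x) (qf\<^sup>2) k"
  let ?B' = "qpoch (?x * qf) qf k * qpoch (qf / ?x) qf k"
  have n: "n > 0" "odd n" using assms by simp_all
  have nd: "\<not> n dvd Suc i" if "i < k" for i
    using assms that by (auto dest: dvd_imp_le)
  have A: "lcong (cyclotomic n) 2 (?A\<^sup>2) ?A'"
    by (rule lcong_sym, rule qpoch_pair_cong) (use n in auto)
  have B: "lcong (cyclotomic n) 2 (?B\<^sup>2) ?B'"
    by (rule lcong_sym, rule qpoch_pair_cong) (use n in auto)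
  have qx: "qf / ?x \<in> ?L"
    unfolding divide_inverse by (intro local_ring_mult inverse_qf_power_local n local_ring_to_fract)
  have A': "?A' \<in> ?L"
    by (intro local_ring_mult qpoch_local qx local_ring_to_fract local_ring_power)
  have iB: "inverse ?B \<in> ?L"
    using inverse_qpoch_qf_local[of n k 0] n nd by simp
  have iC: "inverse ?C \<in> ?L"
    using inverse_qpoch_square_local[of n k 0] n nd by simp
  have "inverse (qpoch (?x * qf) qf k) \<in> ?L"
    using inverse_qpoch_qf_local[of n k n] n nd by (simp add: mult.commute del: add_Suc_right)
  \<comment> \<open>With \<open>j = n - Suc i\<close> the factor is \<open>1 - 1 / qf ^ j\<close>,
    whose inverse \<open>- (qf ^ j) / (1 - qf ^ j)\<close> is integral because
    \<open>0 < j < n\<close>.\<close>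
  moreover have i: "inverse (1 - qf / ?x * qf ^ i) \<in> ?L \<and> qf / ?x * qf ^ i \<noteq> 1" if "i < k" for i
  proof -
    define j where "j = n - Suc i"
    have j: "n = j + Suc i" and "\<not> n dvd j"
      using that assms by (auto simp: j_def dest: dvd_imp_le)
    have x: "?x = qf ^ j * (qf * qf ^ i)"
      by (subst j) (simp add: power_add mult_ac)
    have "- (qf ^ j) * inverse (1 - qf ^ j) \<in> ?L"
      by (intro local_ring_mult local_ring_uminus qf_power_local inverse_1_minus_local n) fact
    moreover have "j \<noteq> 0" using \<open>\<not> n dvd j\<close> by (intro notI) simp
    then have "1 - qf ^ j \<noteq> 0" "qf ^ j - 1 \<noteq> 0"
      using qf_power_eq_1_iff[of j] by auto
    moreover have y: "qf / ?x * qf ^ i = 1 / qf ^ j"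
      unfolding x by simp
    moreover have "- y * inverse (1 - y) = inverse (1 - 1 / y)" if "1 - y \<noteq> 0" "y - 1 \<noteq> 0" "y \<noteq> 0" for y :: "rat poly fract"
      using that by (simp add: divide_simps) (simp add: algebra_simps)
    ultimately show ?thesis
      using qf_power_eq_1_iff[of j] \<open>j \<noteq> 0\<close> by simp
  qed
  then have "inverse (qpoch (qf / ?x) qf k) \<in> ?L"
    by (intro inverse_qpoch_local) simp
  ultimately have iB': "inverse ?B' \<in> ?L"
    unfolding inverse_mult_distrib by (rule local_ring_mult)
  have "?x * qf * qf ^ i \<noteq> 1" for i
    using qf_power_eq_1_iff[of "n + Suc i"] unfolding power_add power_Suc mult.assoc by simp
  then have "?B' \<noteq> 0"
    using i by (simp add: qpoch_nonzero)
  have iB2: "inverse (?B\<^sup>2) \<in> ?L"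
    using local_ring_power[OF iB, of 2] by (simp only: power_inverse)
  have "lcong (cyclotomic n) 2 (?A\<^sup>2 * inverse (?B\<^sup>2)) (?A' * inverse ?B')"
    using \<open>?B' \<noteq> 0\<close> by (intro lcong_mult[OF A] lcong_inverse B iB' iB2 A') simp_all
  then have "lcong (cyclotomic n) 2 ((1 - qf ^ (3 * k + 1)) * ?A * inverse ?C * inverse (qf ^ (Suc k choose 2)) * (?A\<^sup>2 * inverse (?B\<^sup>2)))
     ((1 - qf ^ (3 * k + 1)) * ?A * inverse ?C * inverse (qf ^ (Suc k choose 2)) * (?A' * inverse ?B'))"
    by (rule lcong_scale)
      (intro local_ring_mult local_ring_diff local_ring_1 qf_power_local qpoch_local iC inverse_qf_power_local n local_ring_power local_ring_to_fract)
  also have "(1 - qf ^ (3 * k + 1)) * ?A * inverse ?C * inverse (qf ^ (Suc k choose 2)) * (?A' * inverse ?B') = wz qf ?x k"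
    unfolding wz_def by (simp add: divide_inverse mult_ac)
  also have "(1 - qf ^ (3 * k + 1)) * ?A * inverse ?C * inverse (qf ^ (Suc k choose 2)) * (?A\<^sup>2 * inverse (?B\<^sup>2)) = (1 - qf) * cq qf k"
    unfolding cq_conv_qratio qratio_def one_minus_mult_qint [symmetric]
    by (simp add: divide_inverse mult_ac power2_eq_square power3_eq_cube)
  finally show ?thesis .
qed

text \<open>The half \<open>k \<le> M\<close> is evaluated by \<open>wz_sum\<close>, the other half
  is zero by \<open>cq_vanish\<close>, and \<open>n > 1\<close> makes \<open>1 - qf\<close> a unit
  that can be divided out.\<close>

lemma sum_cq_cong:
  assumes "n = 2 * M + 1" "n > 1"
  shows "lcong (cyclotomic n) 2 (\<Sum>k<n. cq qf k) (qint qf n * inverse (qf ^ M))"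
proof -
  have n: "n > 0" "odd n" using assms by simp_all
  have "lcong (cyclotomic n) 2 (\<Sum>k<n. (1 - qf) * cq qf k) (\<Sum>k<n. if k \<le> M then wz qf (qf ^ n) k else 0)"
  proof (rule lcong_sum)
    fix k assume "k \<in> {..<n}"
    show "lcong (cyclotomic n) 2 ((1 - qf) * cq qf k) (if k \<le> M then wz qf (qf ^ n) k else 0)"
    proof (cases "k \<le> M")
      case True
      then show ?thesis using cq_cong_wz assms(1) by simp
    next
      case False
      then have "lcong (cyclotomic n) 3 (cq qf k) 0"
        using assms \<open>k \<in> {..<n}\<close> by (intro cq_vanish) auto
      then have "lcong (cyclotomic n) 2 (cq qf k) 0"
        by (rule lcong_mono) simp
      then show ?thesis
        using False by (auto intro!: lcong_0_scale)
    qed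
  qed
  also have "(\<Sum>k<n. if k \<le> M then wz qf (qf ^ n) k else 0) = (\<Sum>k\<le>M. wz qf (qf ^ n) k)"
    using assms by (intro sum.mono_neutral_cong_right) auto
  also have "\<dots> = (1 - qf) * qint qf n * inverse (qf ^ M)"
    unfolding one_minus_mult_qint using wz_sum[of qf M] assms(1) by (simp add: divide_inverse)
  finally have "lcong (cyclotomic n) 2 (inverse (1 - qf ^ 1) * (\<Sum>k<n. (1 - qf) * cq qf k))
      (inverse (1 - qf ^ 1) * ((1 - qf) * qint qf n * inverse (qf ^ M)))"
    by (rule lcong_scale) (use assms in \<open>intro inverse_1_minus_local n, simp\<close>)
  moreover have "1 - qf \<noteq> 0"
    using qf_power_eq_1_iff[of 1] by auto
  ultimately show ?thesis
    by (simp flip: sum_distrib_left mult.assoc)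
qed

section \<open>Periodicity modulo \<Phi>_d\<close>

lemma qf_power_cong:
  assumes "d > 0" "[a = b] (mod d)"
  shows "lcong (cyclotomic d) 1 (qf ^ a) (qf ^ b)"
  using assms(2)
proof (induction a b rule: linorder_wlog)
  case (le a b)
  then have "d dvd b - a"
    by (metis cong_def mod_eq_dvd_iff_nat)
  then have "lcong (cyclotomic d) 1 (qf ^ a * qf ^ (b - a)) (qf ^ a * 1)"
    by (intro lcong_scale qf_power_cong_1 assms qf_power_local)
  then show ?case
    using le by (auto intro!: lcong_sym[of _ _ "qf ^ b"] simp flip: power_add)
next
  case (sym a b)
  then show ?case
    using lcong_sym cong_sym by blast
qed

lemma inverse_qf_power_cong:
  assumes "d > 0" "[a = b] (mod d)"
  shows "lcong (cyclotomic d) 1 (inverse (qf ^ a)) (inverse (qf ^ b))"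
  by (intro lcong_inverse qf_power_cong assms inverse_qf_power_local) simp_all

text \<open>Splitting every shifted factorial at \<open>a = m * d\<close> leaves factorials of
  length \<open>r\<close> whose base points are multiplied by powers of \<open>qf\<close> congruent
  to 1. Their denominators are units since \<open>r < d\<close>. The parts of length
  \<open>a\<close> may vanish at \<Phi>_d and only their quotient \<open>qratio qf a\<close> is
  integral, so it is carried along as a factor.\<close>

lemma cq_periodic:
  assumes "odd d" "d > 1" "r < d"
  shows "lcong (cyclotomic d) 1 (cq qf (m * d + r)) (qratio qf (m * d) * cq qf r)"
proof -
  let ?L = "local_ring (cyclotomic d)" and ?\<Phi> = "cyclotomic d"
  define a where "a = m * d"
  have d: "d > 0" and "d dvd a" using assms by (simp_all add: a_def)
  let ?A = "qpoch qf (qf\<^sup>2) r" and ?B = "qpoch qf qf r" and ?C = "qpoch (qf\<^sup>2) (qf\<^sup>2) r"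
  let ?A' = "qpoch (qf * qf ^ (2 * a)) (qf\<^sup>2) r" and ?B' = "qpoch (qf * qf ^ a) qf r"
    and ?C' = "qpoch (qf\<^sup>2 * qf ^ (2 * a)) (qf\<^sup>2) r"
  have nd: "\<not> d dvd a + Suc i" "\<not> d dvd Suc i" if "i < r" for i
    using dvd_add_right_iff[OF \<open>d dvd a\<close>, of "Suc i"] assms that by (auto dest: dvd_imp_le)
  have one: "lcong ?\<Phi> 1 (y * qf ^ i) y" if "d dvd i" "y \<in> ?L" for y i
    using lcong_scale[OF qf_power_cong_1[OF d that(1)] that(2)] by simp
  have A: "lcong ?\<Phi> 1 ?A' ?A"
    by (intro qpoch_cong one) (use \<open>d dvd a\<close> in auto)
  have B: "lcong ?\<Phi> 1 ?B' ?B"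
    by (intro qpoch_cong one) (use \<open>d dvd a\<close> in auto)
  have C: "lcong ?\<Phi> 1 ?C' ?C"
    by (intro qpoch_cong one) (use \<open>d dvd a\<close> in auto)
  have iB: "inverse ?B \<in> ?L" "inverse ?B' \<in> ?L"
    using inverse_qpoch_qf_local[of d r 0] inverse_qpoch_qf_local[of d r a] d nd by simp_all
  have iC: "inverse ?C \<in> ?L" "inverse ?C' \<in> ?L"
    using inverse_qpoch_square_local[of d r 0] inverse_qpoch_square_local[of d r a] assms(1) nd by simp_all
  have split: "qratio qf (a + r) = qratio qf a * (?A' ^ 3 * (inverse ?B' ^ 2 * inverse ?C'))"
    unfolding qratio_def qpoch_add power_mult [symmetric]
    by (simp add: divide_inverse power_mult_distrib power_inverse mult_ac)
  have nz: "?B' \<noteq> 0" "?C' \<noteq> 0"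
    using qpoch_qf_nonzero[of "a + r"] unfolding qpoch_add power_mult [symmetric] by auto
  have q: "qratio qf r = ?A ^ 3 * (inverse ?B ^ 2 * inverse ?C)"
    unfolding qratio_def by (simp add: divide_inverse power_inverse mult_ac)
  have R: "lcong ?\<Phi> 1 (?A' ^ 3 * (inverse ?B' ^ 2 * inverse ?C')) (qratio qf r)"
    unfolding q
    by (rule lcong_mult[OF lcong_power[OF A] lcong_mult[OF lcong_power[OF lcong_inverse[OF B]] lcong_inverse[OF C]]])
      (intro iB iC nz qpoch_qf_nonzero local_ring_mult local_ring_power
          qpoch_local qf_power_local local_ring_to_fract)+
  have I: "lcong ?\<Phi> 1 (qint qf (3 * (a + r) + 1)) (qint qf (3 * r + 1))"
  proof -
    have "[3 * (a + r) + 1 = 3 * r + 1] (mod d)"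
    proof -
      have "3 * (a + r) + 1 = (3 * r + 1) + (3 * m) * d"
        by (simp add: a_def algebra_simps)
      then show ?thesis
        by (simp only: cong_def mod_mult_self1)
    qed
    then have "lcong ?\<Phi> 1 (inverse (1 - qf ^ 1) * (1 - qf ^ (3 * (a + r) + 1))) (inverse (1 - qf ^ 1) * (1 - qf ^ (3 * r + 1)))"
      by (intro lcong_scale lcong_diff lcong_refl qf_power_cong inverse_1_minus_local d) (use assms in auto)
    moreover have "1 - qf \<noteq> 0"
      using qf_power_eq_1_iff[of 1] by auto
    then have "inverse (1 - qf ^ 1) * (1 - qf ^ m) = qint qf m" for m
      unfolding one_minus_mult_qint [of qf m, symmetric] by simp
    ultimately show ?thesis
      by (simp only:)
  qed
  \<comment> \<open>Twice the binomial coefficient is a product of consecutive integers, hence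
    periodic modulo \<open>d\<close>; the 2 cancels as \<open>d\<close> is odd.\<close>
  have "[Suc (a + r) choose 2 = Suc r choose 2] (mod d)"
  proof -
    have "2 * (Suc k choose 2) = Suc k * k" for k
      by (simp add: choose_two)
    moreover have "[Suc (a + r) * (a + r) = Suc r * r] (mod d)"
      using \<open>d dvd a\<close> by (intro cong_mult) (simp_all add: a_def cong_def mod_Suc)
    ultimately have "[2 * (Suc (a + r) choose 2) = 2 * (Suc r choose 2)] (mod d)"
      by (simp only:)
    then show ?thesis
      using assms(1) by (subst (asm) cong_mult_lcancel_nat) auto
  qed
  then have P: "lcong ?\<Phi> 1 (inverse (qf ^ (Suc (a + r) choose 2))) (inverse (qf ^ (Suc r choose 2)))"
    by (rule inverse_qf_power_cong[OF d])
  have "lcong ?\<Phi> 1 (qratio qf a * (qint qf (3 * (a + r) + 1) * (?A' ^ 3 * (inverse ?B' ^ 2 * inverse ?C')) * inverse (qf ^ (Suc (a + r) choose 2))))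
     (qratio qf a * (qint qf (3 * r + 1) * qratio qf r * inverse (qf ^ (Suc r choose 2))))"
    by (rule lcong_scale[OF lcong_mult[OF lcong_mult[OF I R] P]])
      (intro local_ring_mult local_ring_power qint_local qratio_local iB iC inverse_qf_power_local
          qpoch_local qf_power_local local_ring_to_fract assms d)+
  then show ?thesis
    unfolding cq_conv_qratio a_def [symmetric] split by (simp only: mult_ac)
qed

section \<open>The double sum\<close>

text \<open>The triangle becomes a full square with an indicator, so that congruences can be applied
  term by term on rectangular ranges.\<close>

lemma sum_triangle:
  fixes g :: "nat \<Rightarrow> nat \<Rightarrow> 'a::comm_monoid_add"
  assumes "n > 0"
  shows "(\<Sum>k = 0..n - 1. \<Sum>j = 0..k. g j (k - j)) = (\<Sum>j<n. \<Sum>i<n. if j + i < n then g j i else 0)"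
proof -
  have "{0..n - 1} = {..<n}"
    using assms by auto
  then have "(\<Sum>k = 0..n - 1. \<Sum>j = 0..k. g j (k - j)) = (\<Sum>(j, i)\<in>{(j, i). j + i < n}. g j i)"
    by (simp add: sum.triangle_reindex atLeast0AtMost)
  also have "{(j, i). j + i < n} = {p \<in> {..<n} \<times> {..<n}. case p of (j, i) \<Rightarrow> j + i < n}"
    by auto
  also have "(\<Sum>(j, i)\<in>\<dots>. g j i) = (\<Sum>p\<in>{..<n} \<times> {..<n}. if (case p of (j, i) \<Rightarrow> j + i < n) then (case p of (j, i) \<Rightarrow> g j i) else 0)"
    by (subst sum.inter_filter) simp_all
  also have "\<dots> = (\<Sum>j<n. \<Sum>i<n. if j + i < n then g j i else 0)"
    by (auto simp: sum.cartesian_product intro!: sum.cong)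
  finally show ?thesis .
qed

lemma sum_div_mod:
  fixes h :: "nat \<Rightarrow> nat \<Rightarrow> 'a::comm_monoid_add"
  assumes "d > 0"
  shows "(\<Sum>j<N * d. h (j div d) (j mod d)) = (\<Sum>m<N. \<Sum>r<d. h m r)"
proof -
  have "(\<Sum>j<N * d. h (j div d) (j mod d)) = (\<Sum>m<N. \<Sum>j = m * d..<m * d + d. h (j div d) (j mod d))"
    by (rule sum.nat_group [symmetric])
  also have "\<dots> = (\<Sum>m<N. \<Sum>r<d. h m r)"
  proof (rule sum.cong [OF refl])
    fix m
    have "(\<Sum>j = m * d..<m * d + d. h (j div d) (j mod d)) = (\<Sum>r<d. h ((r + m * d) div d) ((r + m * d) mod d))"
      using sum.shift_bounds_nat_ivl[of "\<lambda>j. h (j div d) (j mod d)" 0 "m * d" d]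
      by (simp add: atLeast0LessThan add.commute)
    then show "(\<Sum>j = m * d..<m * d + d. h (j div d) (j mod d)) = (\<Sum>r<d. h m r)"
      using assms by simp
  qed
  finally show ?thesis .
qed

lemma qint_cong_0:
  assumes "d > 1" "d dvd n"
  shows "lcong (cyclotomic d) 1 (qint qf n) 0"
proof -
  have "lcong (cyclotomic d) 1 (1 - qf ^ n) (1 - 1)"
    using assms by (intro lcong_diff lcong_refl qf_power_cong_1) auto
  then have "lcong (cyclotomic d) 1 (inverse (1 - qf ^ 1) * (1 - qf ^ n)) 0"
    using assms by (intro lcong_0_scale inverse_1_minus_local) auto
  moreover have "1 - qf \<noteq> 0"
    using qf_power_eq_1_iff[of 1] by auto
  then have "inverse (1 - qf ^ 1) * (1 - qf ^ n) = qint qf n"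
    unfolding one_minus_mult_qint [of qf n, symmetric] by simp
  ultimately show ?thesis
    by simp
qed

lemma sum_cq_cong_0:
  assumes "odd d" "d > 1"
  shows "lcong (cyclotomic d) 1 (\<Sum>k<d. cq qf k) 0"
proof -
  obtain M where M: "d = 2 * M + 1"
    using assms(1) oddE by blast
  have "lcong (cyclotomic d) 1 (\<Sum>k<d. cq qf k) (qint qf d * inverse (qf ^ M))"
    by (rule lcong_mono[OF sum_cq_cong[OF M assms(2)]]) simp
  also have "lcong (cyclotomic d) 1 \<dots> 0"
    unfolding mult.commute[of "qint qf d"]
    using assms by (intro lcong_0_scale qint_cong_0 inverse_qf_power_local) auto
  finally show ?thesis .
qed

text \<open>Outside the triangle one index exceeds \<open>n / 2\<close>, so the sum may be completed
  to \<open>S * S\<close>. The value \<open>A\<close> of \<open>S\<close> is known only modulo the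
  square of \<Phi>_n; the missing power comes from \<open>S\<close> and \<open>A\<close> both being
  divisible by \<Phi>_n.\<close>

lemma triangle_cong_square:
  assumes "odd n" "n > 1"
  shows "lcong (cyclotomic n) 3 (\<Sum>k = 0..n - 1. \<Sum>j = 0..k. cq qf j * cq qf (k - j)) (qf * (qint qf n)\<^sup>2)"
proof -
  obtain M where M: "n = 2 * M + 1"
    using assms(1) oddE by blast
  let ?\<Phi> = "cyclotomic n"
  define S where "S = (\<Sum>k<n. cq qf k)"
  define A where "A = qint qf n * inverse (qf ^ M)"
  have vanish: "lcong ?\<Phi> 3 0 (cq qf j * cq qf i)" if "n < 2 * i" "i < n" for i j
    by (intro lcong_sym[OF lcong_0_scale] cq_vanish cq_local assms that)
  have "lcong ?\<Phi> 3 (\<Sum>k = 0..n - 1. \<Sum>j = 0..k. cq qf j * cq qf (k - j)) (\<Sum>j<n. \<Sum>i<n. cq qf j * cq qf i)"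
  proof (subst sum_triangle)
    show "lcong ?\<Phi> 3 (\<Sum>j<n. \<Sum>i<n. if j + i < n then cq qf j * cq qf i else 0) (\<Sum>j<n. \<Sum>i<n. cq qf j * cq qf i)"
    proof (intro lcong_sum)
      fix i j assume "j \<in> {..<n}" "i \<in> {..<n}"
      show "lcong ?\<Phi> 3 (if j + i < n then cq qf j * cq qf i else 0) (cq qf j * cq qf i)"
      proof (cases "j + i < n")
        case False
        \<comment> \<open>Two indices \<open>\<le> n / 2\<close> with sum \<open>\<ge> n\<close>
          would both equal \<open>n / 2\<close>, impossible for odd \<open>n\<close>.\<close>
        then have "n < 2 * i \<or> n < 2 * j"
          using M by presburger
        then have "lcong ?\<Phi> 3 0 (cq qf j * cq qf i)"
          using vanish[of i j] vanish[of j i] \<open>j \<in> {..<n}\<close> \<open>i \<in> {..<n}\<close> by (auto simp: mult.commute)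
        then show ?thesis
          using False by simp
      qed simp
    qed
  qed (use assms in simp)
  also have "(\<Sum>j<n. \<Sum>i<n. cq qf j * cq qf i) = S * S"
    by (simp add: S_def sum_product)
  also have "lcong ?\<Phi> 3 (S * S) (A * A)"
  proof -
    have SA: "lcong ?\<Phi> 2 S A"
      unfolding S_def A_def by (rule sum_cq_cong[OF M assms(2)])
    have A0: "lcong ?\<Phi> 1 A 0"
      unfolding A_def mult.commute[of "qint qf n"]
      using assms by (intro lcong_0_scale qint_cong_0 inverse_qf_power_local) auto
    have "lcong ?\<Phi> 2 (S - A) (A - A)"
      by (intro lcong_diff SA lcong_refl)
    moreover have "lcong ?\<Phi> 1 (S + A) (0 + 0)"
      using sum_cq_cong_0[OF assms] A0 unfolding S_def by (rule lcong_add)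
    ultimately have "lcong ?\<Phi> (2 + 1) ((S - A) * (S + A)) 0"
      by (intro lcong_0_mult) simp_all
    then have "lcong ?\<Phi> 3 ((S - A) * (S + A) + A * A) (0 + A * A)"
      by (intro lcong_add lcong_refl) simp
    then show ?thesis
      by (simp add: algebra_simps)
  qed
  \<comment> \<open>\<open>A * A\<close> is
    \<open>inverse (qf ^ (2 * M)) * (qint qf n)\<^sup>2\<close>, and
    \<open>inverse (qf ^ (2 * M)) - qf\<close> contains \<open>1 - qf ^ n\<close>, which supplies a
    third factor \<open>qint qf n\<close>.\<close>
  also have "lcong ?\<Phi> 3 (A * A) (qf * (qint qf n)\<^sup>2)"
  proof -
    have "lcong ?\<Phi> 1 (qint qf n) 0"
      using assms by (intro qint_cong_0) auto
    then have "lcong ?\<Phi> (1 + (1 + 1)) (qint qf n * (qint qf n * qint qf n)) 0"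
      by (intro lcong_0_mult)
    then have "lcong ?\<Phi> 3 (qint qf n * (qint qf n * qint qf n)) 0"
      by (simp add: numeral_3_eq_3)
    then have "lcong ?\<Phi> 3 ((1 - qf) * inverse (qf ^ (2 * M)) * (qint qf n * (qint qf n * qint qf n))) 0"
      by (rule lcong_0_scale)
        (use assms in \<open>intro local_ring_mult local_ring_diff inverse_qf_power_local local_ring_1 local_ring_to_fract, simp\<close>)
    then have "lcong ?\<Phi> 3 ((1 - qf) * inverse (qf ^ (2 * M)) * (qint qf n * (qint qf n * qint qf n)) + qf * (qint qf n)\<^sup>2) (0 + qf * (qint qf n)\<^sup>2)"
      by (intro lcong_add lcong_refl)
    moreover have "(1 - qf) * inverse (qf ^ (2 * M)) * (qint qf n * (qint qf n * qint qf n)) + qf * (qint qf n)\<^sup>2 = A * A"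
    proof -
      have "(1 - qf) * inverse (qf ^ (2 * M)) * (qint qf n * (qint qf n * qint qf n)) =
          (1 - qf ^ n) * inverse (qf ^ (2 * M)) * (qint qf n)\<^sup>2"
        unfolding one_minus_mult_qint [symmetric] by (simp add: power2_eq_square)
      also have "\<dots> = (inverse (qf ^ (2 * M)) - qf) * (qint qf n)\<^sup>2"
        by (simp add: M field_simps)
      finally show ?thesis
        unfolding A_def mult_2 power_add power2_eq_square by (simp add: algebra_simps)
    qed
    ultimately show ?thesis
      by simp
  qed
  finally show ?thesis .
qed

text \<open>With \<open>j = m * d + r\<close> and \<open>i = m' * d + r'\<close>, the condition
  \<open>j + i < n\<close> may be replaced by \<open>m + m' < N\<close>: they differ only where
  \<open>r + r' \<ge> d\<close>, and there one residue exceeds \<open>d / 2\<close>, so the term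
  vanishes. After that \<open>r'\<close> runs freely and its sum is zero by
  \<open>sum_cq_cong_0\<close>.\<close>

lemma triangle_cong_0:
  assumes "odd n" "d dvd n" "d > 1"
  shows "lcong (cyclotomic d) 1 (\<Sum>k = 0..n - 1. \<Sum>j = 0..k. cq qf j * cq qf (k - j)) 0"
proof -
  obtain N where N: "n = N * d"
    using assms(2) by (metis dvdE mult.commute)
  have d: "odd d" "d > 0" and "n > 0"
    using assms N by (auto intro: odd_pos)
  let ?\<Phi> = "cyclotomic d" and ?L = "local_ring (cyclotomic d)"
  have half: "d \<le> a + b \<Longrightarrow> d < 2 * a \<or> d < 2 * b" for a b
    using d(1) by presburger
  define F where "F = (\<lambda>m r. qratio qf (m * d) * cq qf r)"
  have FL: "F m r \<in> ?L" for m r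
    unfolding F_def by (intro local_ring_mult qratio_local cq_local d)
  have F: "lcong ?\<Phi> 1 (cq qf j) (F (j div d) (j mod d))" for j
    using cq_periodic[OF d(1) assms(3), of "j mod d" "j div d"] d(2) unfolding F_def by simp
  have F0: "lcong ?\<Phi> 1 (F m r) 0" if "d < 2 * r" "r < d" for m r
    unfolding F_def by (intro lcong_0_scale lcong_mono[OF cq_vanish] qratio_local d that) simp
  have "lcong ?\<Phi> 1 (\<Sum>j<n. \<Sum>i<n. if j + i < n then cq qf j * cq qf i else 0)
      (\<Sum>j<n. \<Sum>i<n. if j div d + i div d < N then F (j div d) (j mod d) * F (i div d) (i mod d) else 0)"
  proof (intro lcong_sum)
    fix i j
    have ji: "j + i = (j div d + i div d) * d + (j mod d + i mod d)"
      by (simp add: add_mult_distrib)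
    have FF: "lcong ?\<Phi> 1 (cq qf j * cq qf i) (F (j div d) (j mod d) * F (i div d) (i mod d))"
      by (intro lcong_mult F FL cq_local d)
    show "lcong ?\<Phi> 1 (if j + i < n then cq qf j * cq qf i else 0)
      (if j div d + i div d < N then F (j div d) (j mod d) * F (i div d) (i mod d) else 0)"
    proof (cases "j div d + i div d < N")
      case True
      show ?thesis
      proof (cases "j + i < n")
        case False
        have "(j div d + i div d) * d + d \<le> n"
          using True unfolding N by (metis Suc_leI add.commute mult_Suc mult_le_mono1)
        then have "d \<le> j mod d + i mod d"
          using False ji by linarith
        then have "d < 2 * (j mod d) \<or> d < 2 * (i mod d)"
          using half[of "j mod d" "i mod d"] by blast
        then have "lcong ?\<Phi> 1 (F (j div d) (j mod d) * F (i div d) (i mod d)) 0"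
        proof
          assume "d < 2 * (j mod d)"
          then show ?thesis
            unfolding mult.commute[of "F (j div d) (j mod d)"] using d by (intro lcong_0_scale F0 FL) auto
        next
          assume "d < 2 * (i mod d)"
          then show ?thesis
            using d by (intro lcong_0_scale F0 FL) auto
        qed
        then show ?thesis
          using True False by (auto intro: lcong_sym)
      qed (use True FF in simp)
    next
      case False
      then have "N * d \<le> (j div d + i div d) * d"
        by (intro mult_le_mono1) simp
      then have "\<not> j + i < n"
        using ji N by linarith
      then show ?thesis
        using False by simp
    qed
  qed
  also have "lcong ?\<Phi> 1 \<dots> (\<Sum>j<n. 0)"
  proof (rule lcong_sum)
    fix j
    let ?c = "\<lambda>m. j div d + m < N" and ?Fj = "F (j div d) (j mod d)"
    have "(\<Sum>i<n. if ?c (i div d) then ?Fj * F (i div d) (i mod d) else 0) =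
        (\<Sum>m<N. \<Sum>r<d. if ?c m then ?Fj * F m r else 0)"
      unfolding N by (rule sum_div_mod[OF d(2)])
    \<comment> \<open>For fixed \<open>j\<close> the block condition depends on \<open>m\<close>
      alone, so the full sum over \<open>r < d\<close> factors out.\<close>
    also have "\<dots> = (\<Sum>m<N. if ?c m then ?Fj * qratio qf (m * d) * (\<Sum>r<d. cq qf r) else 0)"
      by (intro sum.cong refl) (simp add: F_def sum_distrib_left mult.assoc)
    also have "lcong ?\<Phi> 1 \<dots> (\<Sum>m<N. 0)"
    proof (rule lcong_sum)
      fix m
      have "lcong ?\<Phi> 1 (?Fj * qratio qf (m * d) * (\<Sum>r<d. cq qf r)) 0"
        by (rule lcong_0_scale[OF sum_cq_cong_0[OF d(1) assms(3)]]) (intro local_ring_mult FL qratio_local d)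
      then show "lcong ?\<Phi> 1 (if ?c m then ?Fj * qratio qf (m * d) * (\<Sum>r<d. cq qf r) else 0) 0"
        by simp
    qed
    finally show "lcong ?\<Phi> 1 (\<Sum>i<n. if ?c (i div d) then ?Fj * F (i div d) (i mod d) else 0) 0"
      by simp
  qed
  finally show ?thesis
    using sum_triangle[OF \<open>n > 0\<close>, of "\<lambda>j i. cq qf j * cq qf i"] by simp
qed

section \<open>Combining the cyclotomic moduli\<close>

lemma qint_conv_prod_cyclotomic:
  assumes "n > 0"
  shows "qint indet n = (\<Prod>d\<in>{d. d dvd n} - {1}. cyclotomic d)"
proof -
  have "cyclotomic 1 = indet - 1"
    unfolding cyclotomic_1 indet_def by (simp add: one_pCons)
  then have "(indet - 1) * (\<Prod>d\<in>{d. d dvd n} - {1}. cyclotomic d) = indet ^ n - 1"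
    using assms by (subst prod_cyclotomic[OF assms, symmetric], subst prod.remove[of _ 1]) (auto simp: finite_divisors_nat)
  also have "\<dots> = (indet - 1) * qint indet n"
    using one_minus_mult_qint[of indet n] by (simp add: algebra_simps)
  moreover have "indet - 1 \<noteq> 0"
    by (simp add: indet_def one_pCons)
  ultimately show ?thesis
    by simp
qed

lemma prod_dvd_of_pairwise_coprime:
  fixes f :: "'b \<Rightarrow> 'a::semiring_gcd"
  assumes "\<And>i. i \<in> S \<Longrightarrow> f i dvd x" "\<And>i j. i \<in> S \<Longrightarrow> j \<in> S \<Longrightarrow> i \<noteq> j \<Longrightarrow> coprime (f i) (f j)"
  shows "prod f S dvd x"
  using assms by (induction S rule: infinite_finite_induct) (auto intro!: divides_mult prod_coprime_right)

theorem theorem1p1: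
  fixes n :: nat
  assumes "odd n" and "n > 1"
  shows "ratfun_cong
           (\<Sum>k = 0..n - 1. \<Sum>j = 0..k. cq (to_fract indet) j * cq (to_fract indet) (k - j))
           (to_fract (indet * (qint indet n)\<^sup>2))
           (qint indet n * (cyclotomic n)\<^sup>2)"
proof -
  let ?P = "qint indet n * (cyclotomic n)\<^sup>2"
  define T where "T = (\<Sum>k = 0..n - 1. \<Sum>j = 0..k. cq qf j * cq qf (k - j))"
  define D where "D = T - qf * (qint qf n)\<^sup>2"
  \<comment> \<open>In lowest terms, divisibility of \<open>U\<close> by the modulus forces
    \<open>V\<close> to be coprime to the modulus.\<close>
  define U where "U = fst (quot_of_fract D)"
  define V where "V = snd (quot_of_fract D)"
  have D: "D = to_fract U / to_fract V"
    unfolding U_def V_def Fract_conv_to_fract [symmetric] by (metis quot_to_fract_quot_of_fract quot_to_fract_def case_prod_unfold)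
  have "V \<noteq> 0" "coprime U V"
    unfolding U_def V_def by (simp_all add: coprime_quot_of_fract)
  \<comment> \<open>At \<open>d = n\<close> the exponent 3 collects one \<open>cyclotomic n\<close>
    from \<open>qint indet n\<close> and two from the explicit square.\<close>
  define f where "f = (\<lambda>d. if d = n then cyclotomic n ^ 3 else cyclotomic d)"
  have "f d dvd U" if "d dvd n" "d \<noteq> 1" for d
  proof (cases "d = n")
    case True
    have "lcong (cyclotomic n) 3 D (qf * (qint qf n)\<^sup>2 - qf * (qint qf n)\<^sup>2)"
      unfolding D_def T_def by (intro lcong_diff lcong_refl triangle_cong_square assms)
    then show ?thesis
      using lcong_0_dvd[of "cyclotomic n" 3 U V] \<open>V \<noteq> 0\<close> True by (simp add: f_def D)
  next
    case False
    have "d > 1"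
      using that assms by (cases d) auto
    have "lcong (cyclotomic d) 1 (qf * qint qf n * qint qf n) 0"
      by (intro lcong_0_scale qint_cong_0 local_ring_mult qint_local local_ring_to_fract that \<open>d > 1\<close>)
    then have "lcong (cyclotomic d) 1 D (0 - 0)"
      unfolding D_def T_def by (intro lcong_diff triangle_cong_0 assms that \<open>d > 1\<close>) (simp add: power2_eq_square mult.assoc)
    then show ?thesis
      using lcong_0_dvd[of "cyclotomic d" 1 U V] \<open>V \<noteq> 0\<close> False by (simp add: f_def D)
  qed
  moreover have "coprime (f d) (f e)" if "d dvd n" "e dvd n" "d \<noteq> e" for d e
    using coprime_cyclotomic[of d e] that dvd_pos_nat[of n d] dvd_pos_nat[of n e] assms by (auto simp: f_def)
  ultimately have "(\<Prod>d\<in>{d. d dvd n} - {1}. f d) dvd U"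
    by (intro prod_dvd_of_pairwise_coprime) auto
  also have "(\<Prod>d\<in>{d. d dvd n} - {1}. f d) = f n * (\<Prod>d\<in>{d. d dvd n} - {1} - {n}. f d)"
    using assms by (intro prod.remove) (auto simp: finite_divisors_nat)
  also have "(\<Prod>d\<in>{d. d dvd n} - {1} - {n}. f d) = (\<Prod>d\<in>{d. d dvd n} - {1} - {n}. cyclotomic d)"
    by (intro prod.cong) (auto simp: f_def)
  also have "f n * \<dots> = (cyclotomic n * \<dots>) * (cyclotomic n)\<^sup>2"
    by (simp add: f_def power2_eq_square power3_eq_cube mult_ac)
  also have "cyclotomic n * (\<Prod>d\<in>{d. d dvd n} - {1} - {n}. cyclotomic d) = qint indet n"
    using assms unfolding qint_conv_prod_cyclotomic[OF order.strict_trans[OF zero_less_one assms(2)]]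
    by (intro prod.remove [symmetric]) (auto simp: finite_divisors_nat)
  finally obtain W where W: "U = ?P * W"
    by (elim dvdE)
  have "to_fract (qint indet n) = qint qf n"
    by (simp add: qint_def)
  then have "T - to_fract (indet * (qint indet n)\<^sup>2) = to_fract ?P * (to_fract W / to_fract V)"
    using D unfolding D_def W by simp
  moreover have "coprime V ?P"
    using \<open>coprime U V\<close> unfolding W by (simp add: coprime_commute)
  ultimately show ?thesis
    unfolding ratfun_cong_def T_def using \<open>V \<noteq> 0\<close> by blast
qed

end
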